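(* Let $\mathcal{E}$ be an infinite connected locally finite graph. Then there is a natural isomorphism $$K_0(\mathcal{O}_{\mathcal{E}})\cong H_1(\mathcal{E})\oplus\mathbb{Z}^{\gamma(\mathcal{E})},$$ where $H_1(\mathcal{E})$ is the first (integral) homology group of the geometric realization of $\mathcal{E}$ and $\gamma(\mathcal{E})$ is the cardinality of the valency set of $\mathcal{E}$.
   Context: Graphs are undirected and may have loops and multiple edges; locally finite means that each vertex has finitely many incident edges. For a cardinal $\kappa$, $\mathbb{Z}^{\kappa}$ denotes the free abelian group of rank $\kappa$ (direct sum of $\kappa$ copies of $\mathbb{Z}$). The bi-graph $E=(E^0,E^1,s,r)$ associated to $\mathcal{E}$ is the directed graph (source $s$, range $r$) with the same vertex set in which each edge of $\mathcal{E}$ (including each loop) is replaced by a pair of edges $\{x,\overline{x}\}$ with $s(\overline{x})=r(x)$, $r(\overline{x})=s(x)$ and $\overline{\overline{x}}=x\neq\overline{x}$. Let $\mathbb{Z}^{|E^1|}$ be the free abelian group with basis $E^1$. The Bass–Hashimoto operator $\Phi\colon\mathbb{Z}^{|E^1|}\to\mathbb{Z}^{|E^1|}$ is defined on basis elements by $\Phi(x)=\Big(\sum_{x'\in E^1,\ s(x')=r(x)}x'\Big)-\overline{x}$. Its $0$–$1$ matrix $A=(A_{x,y})_{x,y\in E^1}$ is given by $\Phi(x)=\sum_y A_{x,y}\,y$, and $\mathcal{O}_{\mathcal{E}}$ is the Cuntz–Krieger $C^*$-algebra of $A$, generated by partial isometries $S_x$ ($x\in E^1$), with mutually orthogonal range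 projections, subject to $S_x^*S_x=\sum_y A_{x,y}S_yS_y^*$. By known results, $K_0(\mathcal{O}_{\mathcal{E}})\cong\operatorname{coker}(\mathrm{Id}-\Phi)$; the group $K_0$ is understood through this identification. Valency set: for a subgraph $\mathcal{X}\subseteq\mathcal{E}$, $\mathcal{E}\setminus\mathcal{X}$ denotes the graph whose edges are the edges of $\mathcal{E}$ not in $\mathcal{X}$ and whose vertices are the endpoints of these edges. Choose finite subgraphs $\mathcal{X}_1\subseteq\mathcal{X}_2\subseteq\cdots$ of $\mathcal{E}$ with $\bigcup_k\mathcal{X}_k=\mathcal{E}$, let $V_k$ be the set of infinite connected components of $\mathcal{E}\setminus\mathcal{X}_k$, and for each $k$ choose an injection $\varepsilon_k\colon V_k\to V_{k+1}$ sending each component $\mathcal{Y}\in V_k$ to a component in $V_{k+1}$ that is contained in $\mathcal{Y}$. The valency set is $V=\varinjlim_k V_k$ (direct limit along the $\varepsilon_k$); it is at most countable, its cardinality does not depend on the choices, and $\gamma(\mathcal{E}):=|V|$. "Natural" is used informally, meaning that the isomorphism arises from an explicit construction; no functoriality is asserted. *)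

theory Defs
  imports
    "HOL-Homology.Homology"
    "HOL-Library.Uprod"
    "Graph_Theory.Digraph"
begin

section \<open>Undirected graphs with loops and multiple edges\<close>

text \<open>Endpoints are unordered pairs; an edge \<open>e\<close> with \<open>ends G e = Upair v v\<close> is a loop at \<open>v\<close>.
  The value of \<open>ends G\<close> outside \<open>edges G\<close> is irrelevant.\<close>

record ('v, 'e) mgraph =
  vertices :: "'v set"
  edges :: "'e set"
  ends :: "'e \<Rightarrow> 'v uprod"

definition wf_mgraph :: "('v, 'e) mgraph \<Rightarrow> bool" where
  "wf_mgraph G \<longleftrightarrow> (\<forall>e\<in>edges G. set_uprod (ends G e) \<subseteq> vertices G)"

definition finite_mgraph :: "('v, 'e) mgraph \<Rightarrow> bool" where
  "finite_mgraph G \<longleftrightarrow> finite (vertices G) \<and> finite (edges G)"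

definition locally_finite_mgraph :: "('v, 'e) mgraph \<Rightarrow> bool" where
  "locally_finite_mgraph G \<longleftrightarrow>
     (\<forall>v\<in>vertices G. finite {e \<in> edges G. v \<in> set_uprod (ends G e)})"

definition adjacency :: "('v, 'e) mgraph \<Rightarrow> ('v \<times> 'v) set" where
  "adjacency G = {(u, v). \<exists>e\<in>edges G. ends G e = Upair u v}"

definition connected_mgraph :: "('v, 'e) mgraph \<Rightarrow> bool" where
  "connected_mgraph G \<longleftrightarrow>
     vertices G \<noteq> {} \<and> (\<forall>u\<in>vertices G. \<forall>v\<in>vertices G. (u, v) \<in> (adjacency G)\<^sup>*)"

definition subgraph :: "('v, 'e) mgraph \<Rightarrow> ('v, 'e) mgraph \<Rightarrow> bool" where
  "subgraph H G \<longleftrightarrow> wf_mgraph H \<and> vertices H \<subseteq> vertices G \<and> edges H \<subseteq> edges G \<and>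
     (\<forall>e\<in>edges H. ends H e = ends G e)"

definition component_of :: "('v, 'e) mgraph \<Rightarrow> 'v \<Rightarrow> ('v, 'e) mgraph" where
  "component_of G v =
     (let C = {w \<in> vertices G. (v, w) \<in> (adjacency G)\<^sup>*}
      in \<lparr>vertices = C, edges = {e \<in> edges G. set_uprod (ends G e) \<subseteq> C}, ends = ends G\<rparr>)"

definition components_mgraph :: "('v, 'e) mgraph \<Rightarrow> ('v, 'e) mgraph set" where
  "components_mgraph G = component_of G ` vertices G"

section \<open>The bi-graph and the Bass--Hashimoto operator\<close>

text \<open>Every edge \<open>e\<close> is given an arbitrary auxiliary orientation. The two edges of the bi-graph over
  \<open>e\<close> are \<open>(e, True)\<close>, which follows this orientation, and its inverse \<open>(e, False)\<close>.\<close>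

definition orient :: "('v, 'e) mgraph \<Rightarrow> 'e \<Rightarrow> 'v \<times> 'v" where
  "orient G e = (SOME (u, v). ends G e = Upair u v)"

definition bigraph :: "('v, 'e) mgraph \<Rightarrow> ('v, 'e \<times> bool) pre_digraph" where
  "bigraph G =
     \<lparr>verts = vertices G,
      arcs = edges G \<times> UNIV,
      tail = (\<lambda>(e, b). if b then fst (orient G e) else snd (orient G e)),
      head = (\<lambda>(e, b). if b then snd (orient G e) else fst (orient G e))\<rparr>"

definition rev_arc :: "'e \<times> bool \<Rightarrow> 'e \<times> bool" where
  "rev_arc x = (fst x, \<not> snd x)"

definition bass_hashimoto :: "('v, 'e) mgraph \<Rightarrow> (('e \<times> bool) \<Rightarrow>\<^sub>0 int) \<Rightarrow> (('e \<times> bool) \<Rightarrow>\<^sub>0 int)" where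
  "bass_hashimoto G = frag_extend (\<lambda>x.
     (\<Sum>x' | x' \<in> arcs (bigraph G) \<and> tail (bigraph G) x' = head (bigraph G) x. frag_of x')
     - frag_of (rev_arc x))"

text \<open>\<open>K\<^sub>0\<close> of the Cuntz--Krieger algebra attached to \<open>G\<close>, under the known identification with the
  cokernel of \<open>Id - \<Phi>\<close>, where \<open>\<Phi>\<close> is the Bass--Hashimoto operator.\<close>

definition K0 :: "('v, 'e) mgraph \<Rightarrow> (('e \<times> bool) \<Rightarrow>\<^sub>0 int) set monoid" where
  "K0 G = free_Abelian_group (arcs (bigraph G)) Mod
     ((\<lambda>c. c - bass_hashimoto G c) ` carrier (free_Abelian_group (arcs (bigraph G))))"

section \<open>Geometric realization\<close>

datatype ('v, 'e) realization_point = Vertex 'v | Inner 'e real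

text \<open>The characteristic map of the edge \<open>e\<close> on the unit interval.\<close>

definition char_map :: "('v, 'e) mgraph \<Rightarrow> 'e \<Rightarrow> real \<Rightarrow> ('v, 'e) realization_point" where
  "char_map G e t =
     (if t = 0 then Vertex (fst (orient G e))
      else if t = 1 then Vertex (snd (orient G e))
      else Inner e t)"

text \<open>The quotient topology from the disjoint union of the discrete space of vertices and one unit
  interval for each edge. The discrete summand imposes no condition on open sets.\<close>

definition geometric_realization :: "('v, 'e) mgraph \<Rightarrow> ('v, 'e) realization_point topology" where
  "geometric_realization G = topology (\<lambda>U.
     U \<subseteq> Vertex ` vertices G \<union> (\<Union>e\<in>edges G. char_map G e ` {0..1}) \<and>
     (\<forall>e\<in>edges G. openin (top_of_set {0..1}) {t \<in> {0..1}. char_map G e t \<in> U}))"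

lemma openin_geometric_realization:
  "openin (geometric_realization G) U \<longleftrightarrow>
     U \<subseteq> Vertex ` vertices G \<union> (\<Union>e\<in>edges G. char_map G e ` {0..1}) \<and>
     (\<forall>e\<in>edges G. openin (top_of_set {0..1}) {t \<in> {0..1}. char_map G e t \<in> U})"
proof -
  have "istopology (\<lambda>U. U \<subseteq> C \<and>
      (\<forall>e\<in>edges G. openin (top_of_set {0..1}) {t \<in> {0..1}. char_map G e t \<in> U}))"
    for C :: "('a, 'b) realization_point set"
  proof -
    have Int: "{t \<in> {0..1}. char_map G e t \<in> S \<inter> T} =
        {t \<in> {0..1}. char_map G e t \<in> S} \<inter> {t \<in> {0..1}. char_map G e t \<in> T}" for e S T
      by auto
    have Un: "{t \<in> {0..1}. char_map G e t \<in> \<Union>\<K>} =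
        (\<Union>K\<in>\<K>. {t \<in> {0..1}. char_map G e t \<in> K})" for e \<K>
      by auto
    show ?thesis
      unfolding istopology_def Int Un by (auto intro!: openin_Int openin_Union)
  qed
  then show ?thesis
    unfolding geometric_realization_def by (subst topology_inverse') simp_all
qed

section \<open>The valency set\<close>

definition remove_subgraph :: "('v, 'e) mgraph \<Rightarrow> ('v, 'e) mgraph \<Rightarrow> ('v, 'e) mgraph" where
  "remove_subgraph G X =
     \<lparr>vertices = (\<Union>e\<in>edges G - edges X. set_uprod (ends G e)),
      edges = edges G - edges X,
      ends = ends G\<rparr>"

definition infinite_components :: "('v, 'e) mgraph \<Rightarrow> ('v, 'e) mgraph \<Rightarrow> ('v, 'e) mgraph set" where
  "infinite_components G X = {Y \<in> components_mgraph (remove_subgraph G X). \<not> finite_mgraph Y}"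

definition finite_exhaustion :: "('v, 'e) mgraph \<Rightarrow> (nat \<Rightarrow> ('v, 'e) mgraph) \<Rightarrow> bool" where
  "finite_exhaustion G X \<longleftrightarrow>
     (\<forall>k. subgraph (X k) G \<and> finite_mgraph (X k) \<and> subgraph (X k) (X (Suc k))) \<and>
     (\<Union>k. vertices (X k)) = vertices G \<and> (\<Union>k. edges (X k)) = edges G"

definition valency_choice ::
  "('v, 'e) mgraph \<Rightarrow> (nat \<Rightarrow> ('v, 'e) mgraph) \<Rightarrow>
     (nat \<Rightarrow> ('v, 'e) mgraph \<Rightarrow> ('v, 'e) mgraph) \<Rightarrow> bool" where
  "valency_choice G X \<epsilon> \<longleftrightarrow> finite_exhaustion G X \<and>
     (\<forall>k. inj_on (\<epsilon> k) (infinite_components G (X k)) \<and>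
        (\<forall>Y\<in>infinite_components G (X k).
           \<epsilon> k Y \<in> infinite_components G (X (Suc k)) \<and> subgraph (\<epsilon> k Y) Y))"

text \<open>\<open>transition f j d\<close> is the composite \<open>f (j + d - 1) \<circ> \<dots> \<circ> f j\<close>, mapping stage \<open>j\<close>
  to stage \<open>j + d\<close>.\<close>

primrec transition :: "(nat \<Rightarrow> 'a \<Rightarrow> 'a) \<Rightarrow> nat \<Rightarrow> nat \<Rightarrow> 'a \<Rightarrow> 'a" where
  "transition f j 0 a = a"
| "transition f j (Suc d) a = f (j + d) (transition f j d a)"

definition direct_limit :: "(nat \<Rightarrow> 'a set) \<Rightarrow> (nat \<Rightarrow> 'a \<Rightarrow> 'a) \<Rightarrow> (nat \<times> 'a) set set" where
  "direct_limit A f = Sigma UNIV A //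
     {((j, a), (k, b)). a \<in> A j \<and> b \<in> A k \<and>
        (\<exists>n. j \<le> n \<and> k \<le> n \<and> transition f j (n - j) a = transition f k (n - k) b)}"

definition valency_set ::
  "('v, 'e) mgraph \<Rightarrow> (nat \<Rightarrow> ('v, 'e) mgraph) \<Rightarrow>
     (nat \<Rightarrow> ('v, 'e) mgraph \<Rightarrow> ('v, 'e) mgraph) \<Rightarrow> (nat \<times> ('v, 'e) mgraph) set set" where
  "valency_set G X \<epsilon> = direct_limit (\<lambda>k. infinite_components G (X k)) \<epsilon>"

end

theory Submission
  imports Defs "HOL-Analysis.Abstract_Topological_Spaces"
begin

text \<open>
  Fix a breadth-first spanning tree with root \<open>r\<close>. Writing \<open>x\<^sub>v\<close> for the tree edge leading to \<open>v\<close>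
  and \<open>x\<^sub>r\<close> for the common value of all \<open>x + rev x\<close>, the cokernel of \<open>Id - \<Phi>\<close> is generated by the
  \<open>x\<^sub>v\<close> and the chords (non-tree edges), with one relation at every vertex \<open>v\<close>:
  \<open>x\<^sub>v\<close> is the sum of the \<open>x\<^sub>w\<close> over the children \<open>w\<close> of \<open>v\<close> and of the chords leaving \<open>v\<close>.
  If the subtree below \<open>v\<close> is infinite, solve this relation for one preferred child with infinite
  subtree, otherwise solve it for \<open>x\<^sub>v\<close>. This shows that \<open>K\<^sub>0\<close> is free on the chords and on the
  starting points of the rays of preferred children.

  On the topological side, the realization minus one point of every chord is contractible, since
  every point can be pulled back to the root along the tree. Two such subspaces cover the
  realization, and the path components of their intersection are one tree and one segment per
  chord, so that \<open>\<int> \<oplus> H\<^sub>1\<close> is free on one generator more than the number of chords.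

  If there are infinitely many chords, both groups are free of countably infinite rank. Otherwise
  late graphs of the exhaustion contain all chords, and counting the infinite components of their
  complements is counting rays, so that the rays are equinumerous with the valency set.
\<close>

section \<open>Rooted spanning trees of the graph\<close>

text \<open>For an arc \<open>x\<close>, the element \<open>x - \<Phi> x\<close> is
  \<open>x + rev x\<close> minus the sum of the arcs leaving the target of \<open>x\<close>. The
  reverse arc has the same \<open>x + rev x\<close>, so outgoing sums at adjacent vertices agree in
  the cokernel; by connectedness they all agree, and this is the common value. The elimination
  involves infinitely many generators. Always replacing a vertex by its children would never end on
  an infinite path; this is why a vertex with infinite subtree has its relation solved for a child,
  so that substitutions there move towards the root. The homology argument yields H_1 only together
  with a summand Z. It is not cancelled but paid for by one element of the valency set, which is
  nonempty. The case split on chords is forced: chords outside every finite subgraph can tie two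
  rays to the same infinite components, so rays and valency set need not be equinumerous in general.
  Moreover the injections \<epsilon> are arbitrary and ignore the tree, so stages are compared by
  cardinality and not by maps.\<close>

abbreviation src :: "('v, 'e) mgraph \<Rightarrow> 'e \<times> bool \<Rightarrow> 'v" where
  "src G \<equiv> tail (bigraph G)"

abbreviation tgt :: "('v, 'e) mgraph \<Rightarrow> 'e \<times> bool \<Rightarrow> 'v" where
  "tgt G \<equiv> head (bigraph G)"

lemma arcs_bigraph: "arcs (bigraph G) = edges G \<times> UNIV"
  by (simp add: bigraph_def)

lemma src_eq: "src G (e, b) = (if b then fst (orient G e) else snd (orient G e))"
  and tgt_eq: "tgt G (e, b) = (if b then snd (orient G e) else fst (orient G e))"
  by (simp_all add: bigraph_def)

lemma rev_arc_rev_arc [simp]: "rev_arc (rev_arc x) = x"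
  by (simp add: rev_arc_def)

lemma fst_rev_arc [simp]: "fst (rev_arc x) = fst x"
  by (simp add: rev_arc_def)

lemma rev_arc_neq [simp]: "rev_arc x \<noteq> x" "x \<noteq> rev_arc x"
  by (simp_all add: rev_arc_def prod_eq_iff)

lemma rev_arc_in_arcs [simp]: "rev_arc x \<in> arcs (bigraph G) \<longleftrightarrow> x \<in> arcs (bigraph G)"
  by (cases x) (simp add: rev_arc_def arcs_bigraph)

lemma src_rev_arc [simp]: "src G (rev_arc x) = tgt G x"
  and tgt_rev_arc [simp]: "tgt G (rev_arc x) = src G x"
  by (cases x; simp add: rev_arc_def src_eq tgt_eq)+

lemma fst_eq_arc_cases: "fst x = fst y \<longleftrightarrow> x = y \<or> x = rev_arc y"
  by (cases x; cases y) (auto simp: rev_arc_def)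

lemma ends_orient: "ends G e = Upair (fst (orient G e)) (snd (orient G e))"
proof -
  obtain u v where "ends G e = Upair u v"
    by (metis uprod_exhaust)
  then have "case (u, v) of (u, v) \<Rightarrow> ends G e = Upair u v"
    by simp
  then have "case orient G e of (u, v) \<Rightarrow> ends G e = Upair u v"
    unfolding orient_def by (rule someI)
  then show ?thesis
    by (simp add: case_prod_beta)
qed

lemma set_ends_arc: "set_uprod (ends G (fst x)) = {src G x, tgt G x}"
  by (cases x) (auto simp: ends_orient src_eq tgt_eq)

lemma adjacency_eq_arcs: "adjacency G = {(src G x, tgt G x) |x. x \<in> arcs (bigraph G)}"
proof -
  \<comment> \<open>The Boolean of the witness records whether \<open>(u, v)\<close> is the chosen
    orientation of \<open>e\<close>. At a loop it is \<open>True\<close>, and both arcs over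
    \<open>e\<close> have the same ends.\<close>
  have "\<exists>x. u = src G x \<and> v = tgt G x \<and> x \<in> arcs (bigraph G)"
    if "e \<in> edges G" "ends G e = Upair u v" for e u v
    using that ends_orient[of G e]
    by (intro exI[of _ "(e, (u, v) = orient G e)"])
      (auto simp: arcs_bigraph src_eq tgt_eq prod_eq_iff Upair_inject split: if_splits)
  moreover have "ends G (fst x) = Upair (src G x) (tgt G x)" for x
    by (cases x) (auto simp: ends_orient src_eq tgt_eq Upair_inject)
  ultimately show ?thesis
    unfolding adjacency_def by (fastforce simp: arcs_bigraph)
qed

lemma sym_adjacency: "sym (adjacency G)"
proof (rule symI)
  fix u v assume "(u, v) \<in> adjacency G"
  then obtain x where "x \<in> arcs (bigraph G)" "u = src G x" "v = tgt G x"
    by (auto simp: adjacency_eq_arcs)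
  then show "(v, u) \<in> adjacency G"
    unfolding adjacency_eq_arcs by (auto intro!: exI[of _ "rev_arc x"] simp del: split_paired_Ex)
qed

lemma wf_mgraph_arc_ends:
  assumes "wf_mgraph G" "x \<in> arcs (bigraph G)"
  shows "src G x \<in> vertices G" "tgt G x \<in> vertices G"
proof -
  have "set_uprod (ends G (fst x)) \<subseteq> vertices G"
    using assms by (auto simp: wf_mgraph_def arcs_bigraph)
  then show "src G x \<in> vertices G" "tgt G x \<in> vertices G"
    by (simp_all add: set_ends_arc)
qed

lemma locally_finite_arcs:
  assumes "locally_finite_mgraph G" "v \<in> vertices G"
  shows "finite {x \<in> arcs (bigraph G). src G x = v}" "finite {x \<in> arcs (bigraph G). tgt G x = v}"
proof -
  have fin: "finite ({e \<in> edges G. v \<in> set_uprod (ends G e)} \<times> (UNIV :: bool set))"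
    using assms by (simp add: locally_finite_mgraph_def)
  have *: "{x \<in> arcs (bigraph G). v \<in> set_uprod (ends G (fst x))} \<subseteq>
      {e \<in> edges G. v \<in> set_uprod (ends G e)} \<times> (UNIV :: bool set)"
    by (auto simp: arcs_bigraph)
  show "finite {x \<in> arcs (bigraph G). src G x = v}"
    by (rule finite_subset[OF _ finite_subset[OF * fin]]) (auto simp: set_ends_arc simp del: split_paired_All)
  show "finite {x \<in> arcs (bigraph G). tgt G x = v}"
    by (rule finite_subset[OF _ finite_subset[OF * fin]]) (auto simp: set_ends_arc simp del: split_paired_All)
qed

text \<open>An infinite graph could owe its size to its edges alone; local finiteness excludes this,
  so the spanning tree is infinite.\<close>

lemma infinite_vertices:
  assumes "locally_finite_mgraph G" "wf_mgraph G" "\<not> finite_mgraph G"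
  shows "infinite (vertices G)"
proof
  assume fin: "finite (vertices G)"
  have "edges G \<subseteq> (\<Union>v\<in>vertices G. {e \<in> edges G. v \<in> set_uprod (ends G e)})"
    using assms(2) by (fastforce simp: wf_mgraph_def ends_orient)
  moreover have "finite (\<Union>v\<in>vertices G. {e \<in> edges G. v \<in> set_uprod (ends G e)})"
    using fin assms(1) by (simp add: locally_finite_mgraph_def)
  ultimately have "finite (edges G)"
    by (rule finite_subset)
  then show False
    using assms(3) fin by (simp add: finite_mgraph_def)
qed

text \<open>Connectedness is encoded by \<open>pa\<close>: walking back along parent arcs lowers
  \<open>dist\<close> by one each time and so ends at \<open>r\<close>. Nothing is said about
  \<open>pa r\<close>.\<close>

locale rooted_graph =
  fixes G :: "('v, 'e) mgraph" and r :: 'v and dist :: "'v \<Rightarrow> nat" and pa :: "'v \<Rightarrow> 'e \<times> bool"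
  assumes wf: "wf_mgraph G"
    and loc_fin: "locally_finite_mgraph G"
    and inf_vertices: "infinite (vertices G)"
    and root: "r \<in> vertices G" "dist r = 0"
    and pa: "\<And>v. v \<in> vertices G \<Longrightarrow> v \<noteq> r \<Longrightarrow>
      pa v \<in> arcs (bigraph G) \<and> tgt G (pa v) = v \<and> dist v = Suc (dist (src G (pa v)))"

text \<open>The last step of a shortest walk to \<open>v\<close> starts at a vertex that is at most
  one level closer by minimality and at least one by the walk itself. Its arc is therefore a
  legitimate parent arc.\<close>

lemma exists_rooted_graph:
  assumes "wf_mgraph G" "\<not> finite_mgraph G" "connected_mgraph G" "locally_finite_mgraph G"
  obtains r dist pa where "rooted_graph G r dist pa"
proof -
  obtain r where r: "r \<in> vertices G"
    using assms(3) by (auto simp: connected_mgraph_def)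
  define dist where "dist v = (LEAST n. (r, v) \<in> adjacency G ^^ n)" for v
  have dist: "(r, v) \<in> adjacency G ^^ dist v" if "v \<in> vertices G" for v
  proof -
    have "(r, v) \<in> (adjacency G)\<^sup>*"
      using assms(3) r that by (auto simp: connected_mgraph_def)
    then have "\<exists>n. (r, v) \<in> adjacency G ^^ n"
      by (simp add: rtrancl_power)
    then show ?thesis
      unfolding dist_def by (rule LeastI_ex)
  qed
  have dist_le: "dist v \<le> n" if "(r, v) \<in> adjacency G ^^ n" for v n
    using that unfolding dist_def by (rule Least_le)
  have ex: "\<exists>x. x \<in> arcs (bigraph G) \<and> tgt G x = v \<and> dist v = Suc (dist (src G x))"
    if v: "v \<in> vertices G" "v \<noteq> r" for v
  proof -
    have "dist v \<noteq> 0"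
      using dist[OF v(1)] v(2) by (metis relpow_0_E)
    then obtain n where n: "dist v = Suc n"
      using not0_implies_Suc by blast
    have "(r, v) \<in> adjacency G ^^ Suc n"
      using dist[OF v(1)] n by simp
    then obtain u where u: "(r, u) \<in> adjacency G ^^ n" "(u, v) \<in> adjacency G"
      by (rule relpow_Suc_E)
    then obtain x where x: "x \<in> arcs (bigraph G)" "src G x = u" "tgt G x = v"
      by (auto simp: adjacency_eq_arcs)
    have "(r, v) \<in> adjacency G ^^ Suc (dist u)"
      using u(2) dist[of u] wf_mgraph_arc_ends(1)[OF assms(1) x(1)] x(2) by auto
    then have "dist v \<le> Suc (dist u)"
      by (rule dist_le)
    moreover have "dist u \<le> n"
      using u(1) by (rule dist_le)
    ultimately have "dist v = Suc (dist (src G x))"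
      using x n by simp
    then show ?thesis
      using x by blast
  qed
  have "dist r = 0"
    using dist_le[of r 0] by simp
  then have "rooted_graph G r dist
      (\<lambda>v. SOME x. x \<in> arcs (bigraph G) \<and> tgt G x = v \<and> dist v = Suc (dist (src G x)))"
    using someI_ex[OF ex] assms r infinite_vertices[of G] by unfold_locales auto
  then show ?thesis
    by (rule that)
qed

context rooted_graph
begin

abbreviation "V \<equiv> vertices G"

definition par :: "'v \<Rightarrow> 'v" where "par v = src G (pa v)"

definition tree_edges :: "'e set" where "tree_edges = (\<lambda>v. fst (pa v)) ` (V - {r})"

definition chords :: "'e set" where "chords = edges G - tree_edges"

definition children :: "'v \<Rightarrow> 'v set" where "children v = {w \<in> V - {r}. par w = v}"

lemma pa_arc: "v \<in> V - {r} \<Longrightarrow> pa v \<in> arcs (bigraph G)"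
  and tgt_pa: "v \<in> V - {r} \<Longrightarrow> tgt G (pa v) = v"
  and src_pa: "v \<in> V - {r} \<Longrightarrow> src G (pa v) = par v"
  and dist_par: "v \<in> V - {r} \<Longrightarrow> dist v = Suc (dist (par v))"
  using pa by (auto simp: par_def)

lemma par_in_V: "v \<in> V - {r} \<Longrightarrow> par v \<in> V"
  using wf_mgraph_arc_ends(1)[OF wf] pa_arc by (simp add: par_def)

lemma dist_eq_0: "v \<in> V \<Longrightarrow> dist v = 0 \<longleftrightarrow> v = r"
  using dist_par[of v] root by (metis Diff_iff Suc_neq_Zero singletonD)

text \<open>Parent arcs over the same edge are equal or mutually reverse. In the second case each of
  \<open>v\<close> and \<open>w\<close> would be the parent of the other and hence one level above
  it.\<close>

lemma fst_pa_inj: "\<lbrakk>v \<in> V - {r}; w \<in> V - {r}; fst (pa v) = fst (pa w)\<rbrakk> \<Longrightarrow> v = w"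
proof -
  assume v: "v \<in> V - {r}" and w: "w \<in> V - {r}" and "fst (pa v) = fst (pa w)"
  then consider "pa v = pa w" | "pa v = rev_arc (pa w)"
    using fst_eq_arc_cases by blast
  then show "v = w"
  proof cases
    case 1
    then show ?thesis using tgt_pa[OF v] tgt_pa[OF w] by argo
  next
    case 2
    then have "tgt G (pa v) = src G (pa w)" "src G (pa v) = tgt G (pa w)"
      by simp_all
    then have "par w = v" "par v = w"
      using tgt_pa[OF v] tgt_pa[OF w] src_pa[OF w] src_pa[OF v] by argo+
    then have "dist v = Suc (dist w)" "dist w = Suc (dist v)"
      using dist_par[OF v] dist_par[OF w] by argo+
    then show ?thesis by simp
  qed
qed

lemma pa_not_rev: "\<lbrakk>v \<in> V - {r}; w \<in> V - {r}\<rbrakk> \<Longrightarrow> pa v \<noteq> rev_arc (pa w)"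
  using fst_pa_inj[of v w] by (metis fst_rev_arc rev_arc_neq(2))

lemma pa_tree: "v \<in> V - {r} \<Longrightarrow> fst (pa v) \<in> tree_edges"
  by (auto simp: tree_edges_def)

lemma tree_edges_subset: "tree_edges \<subseteq> edges G"
  using pa_arc by (auto simp: tree_edges_def arcs_bigraph mem_Times_iff)

lemma arc_cases:
  assumes "x \<in> arcs (bigraph G)"
  obtains (chord) "fst x \<in> chords"
  | (down) v where "v \<in> V - {r}" "x = pa v"
  | (up) v where "v \<in> V - {r}" "x = rev_arc (pa v)"
proof -
  have "fst x \<in> chords \<or> fst x \<in> tree_edges"
    using assms by (auto simp: chords_def arcs_bigraph)
  then show thesis
    using chord down up unfolding tree_edges_def by (metis (no_types, lifting) fst_eq_arc_cases imageE)
qed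

lemma finite_children: "v \<in> V \<Longrightarrow> finite (children v)"
proof -
  assume v: "v \<in> V"
  have "inj_on pa (children v)"
    using tgt_pa unfolding inj_on_def children_def by (metis (mono_tags, lifting) mem_Collect_eq)
  moreover have "pa ` children v \<subseteq> {x \<in> arcs (bigraph G). src G x = v}"
    using pa_arc src_pa by (auto simp: children_def)
  ultimately show ?thesis
    using locally_finite_arcs(1)[OF loc_fin v] finite_imageD finite_subset by blast
qed

lemma funpow_par:
  assumes "v \<in> V" "n \<le> dist v"
  shows "(par ^^ n) v \<in> V \<and> dist ((par ^^ n) v) = dist v - n"
  using assms(2)
proof (induction n)
  case (Suc n)
  then have IH: "(par ^^ n) v \<in> V" "dist ((par ^^ n) v) = dist v - n"
    by auto
  then have "(par ^^ n) v \<in> V - {r}"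
    using Suc.prems root by auto
  then show ?case
    using dist_par[of "(par ^^ n) v"] par_in_V IH(2) by auto
qed (use assms in auto)

text \<open>The ancestor of \<open>v\<close> at distance \<open>L\<close> from the root; for \<open>L > dist v\<close> the subtraction is truncated
  and \<open>anc L v = v\<close>.\<close>

definition anc :: "nat \<Rightarrow> 'v \<Rightarrow> 'v" where "anc L v = (par ^^ (dist v - L)) v"

lemma anc_in_V: "v \<in> V \<Longrightarrow> anc L v \<in> V"
  and dist_anc: "v \<in> V \<Longrightarrow> L \<le> dist v \<Longrightarrow> dist (anc L v) = L"
  using funpow_par[of v "dist v - L"] by (auto simp: anc_def)

lemma anc_self [simp]: "anc (dist v) v = v"
  by (simp add: anc_def)

lemma anc_par: "v \<in> V - {r} \<Longrightarrow> L < dist v \<Longrightarrow> anc L (par v) = anc L v"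
proof -
  assume v: "v \<in> V - {r}" and L: "L < dist v"
  have "dist v - L = Suc (dist (par v) - L)"
    using dist_par[OF v] L by simp
  then show ?thesis
    by (simp add: anc_def funpow_swap1)
qed

section \<open>Infinite subtrees and preferred children\<close>

definition desc :: "'v \<Rightarrow> 'v set" where "desc v = {w \<in> V. dist v \<le> dist w \<and> anc (dist v) w = v}"

text \<open>By local finiteness these are the vertices at which an infinite descending path
  starts.\<close>

definition live :: "'v \<Rightarrow> bool" where "live v \<longleftrightarrow> v \<in> V \<and> infinite (desc v)"

lemma self_in_desc: "v \<in> V \<Longrightarrow> v \<in> desc v"
  by (simp add: desc_def)

lemma desc_root: "desc r = V"
proof -
  have "anc 0 w = r" if "w \<in> V" for w
    using dist_anc[OF that, of 0] anc_in_V[OF that, of 0] dist_eq_0 by auto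
  then show ?thesis
    by (auto simp: desc_def root)
qed

lemma live_root: "live r"
  using inf_vertices by (simp add: live_def desc_root root)

lemma desc_children:
  assumes v: "v \<in> V"
  shows "desc v = insert v (\<Union>w\<in>children v. desc w)"
proof (intro equalityI subsetI)
  fix w assume w: "w \<in> desc v"
  then have wV: "w \<in> V" "dist v \<le> dist w" "anc (dist v) w = v"
    by (auto simp: desc_def)
  show "w \<in> insert v (\<Union>w\<in>children v. desc w)"
  proof (cases "dist w = dist v")
    case True
    then show ?thesis using wV by (metis anc_self insertI1)
  next
    case False
    define u where "u = anc (Suc (dist v)) w"
    have u: "u \<in> V" "dist u = Suc (dist v)"
      using anc_in_V[OF wV(1)] dist_anc[OF wV(1), of "Suc (dist v)"] False wV(2) by (auto simp: u_def)
    then have ur: "u \<in> V - {r}"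
      using root by auto
    have "Suc (dist w - Suc (dist v)) = dist w - dist v"
      using False wV(2) by simp
    then have "par u = v"
      using wV(3) unfolding u_def anc_def by (metis comp_apply funpow.simps(2))
    then have "u \<in> children v" "w \<in> desc u"
      using ur wV False u by (auto simp: children_def desc_def u_def)
    then show ?thesis by auto
  qed
next
  fix w assume "w \<in> insert v (\<Union>w\<in>children v. desc w)"
  then consider "w = v" | u where "u \<in> children v" "w \<in> desc u"
    by auto
  then show "w \<in> desc v"
  proof cases
    case 2
    then have u: "u \<in> V - {r}" "par u = v" and w: "w \<in> V" "dist u \<le> dist w" "anc (dist u) w = u"
      by (auto simp: children_def desc_def)
    have "dist w - dist v = Suc (dist w - dist u)"
      using w(2) dist_par[OF u(1)] u(2) by simp
    then have "anc (dist v) w = v"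
      using w(3) u(2) by (simp add: anc_def)
    then show ?thesis
      using w dist_par[OF u(1)] u(2) by (auto simp: desc_def)
  qed (use v self_in_desc in auto)
qed

text \<open>One step of Koenig's lemma: there are finitely many children, and finitely many finite
  subtrees cannot make up an infinite one.\<close>

lemma live_child: "live v \<Longrightarrow> \<exists>w\<in>children v. live w"
proof (rule ccontr)
  assume v: "live v" and *: "\<not> (\<exists>w\<in>children v. live w)"
  then have "finite (desc w)" if "w \<in> children v" for w
    using that by (auto simp: live_def children_def)
  then have "finite (desc v)"
    using v finite_children[of v] by (simp add: desc_children live_def)
  then show False
    using v by (simp add: live_def)
qed

lemma live_par: "\<lbrakk>w \<in> children v; live w; v \<in> V\<rbrakk> \<Longrightarrow> live v"
  using desc_children[of v] unfolding live_def by (metis UN_upper finite_insert finite_subset subset_insertI2)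

text \<open>The preferred child is the generator for which the relation at a live vertex is solved;
  the other live children remain free generators and start new rays.\<close>

definition pc :: "'v \<Rightarrow> 'v" where "pc v = (SOME w. w \<in> children v \<and> live w)"

lemma pc: "live v \<Longrightarrow> pc v \<in> children v \<and> live (pc v)"
  unfolding pc_def by (rule someI_ex) (use live_child in blast)

lemma pc_in: "live v \<Longrightarrow> pc v \<in> V - {r}"
  and par_pc: "live v \<Longrightarrow> par (pc v) = v"
  and live_pc: "live v \<Longrightarrow> live (pc v)"
  and dist_pc: "live v \<Longrightarrow> dist (pc v) = Suc (dist v)"
  using pc[of v] dist_par[of "pc v"] by (auto simp: children_def)

text \<open>The starting points of the rays obtained by following \<^term>\<open>pc\<close>; these rays partition the
  live vertices.\<close>

definition ray_starts :: "'v set" where "ray_starts = {v. live v \<and> v \<notin> pc ` Collect live}"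

lemma root_ray_start: "r \<in> ray_starts"
  using live_root pc_in by (force simp: ray_starts_def)

lemma finite_level: "finite {v \<in> V. dist v = n}"
proof (induction n)
  case 0
  have "{v \<in> V. dist v = 0} \<subseteq> {r}" using dist_eq_0 by auto
  then show ?case using finite_subset by blast
next
  case (Suc n)
  have "{v \<in> V. dist v = Suc n} \<subseteq> (\<Union>u\<in>{v \<in> V. dist v = n}. children u)"
  proof
    fix v assume "v \<in> {v \<in> V. dist v = Suc n}"
    then have "v \<in> V - {r}" "dist v = Suc n"
      using root by auto
    then show "v \<in> (\<Union>u\<in>{v \<in> V. dist v = n}. children u)"
      using dist_par[of v] par_in_V[of v] by (auto simp: children_def)
  qed
  then show ?case
    using Suc finite_children by (auto intro: finite_subset)
qed

lemma countable_vertices: "countable V"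
proof -
  have "countable (\<Union>n. {v \<in> V. dist v = n})"
    by (rule countable_UN[OF countableI_type]) (simp add: finite_level countable_finite)
  moreover have "(\<Union>n. {v \<in> V. dist v = n}) = V"
    by auto
  ultimately show ?thesis
    by simp
qed

end

section \<open>Eliminating generators\<close>

lemma frag_extend_eq_comp:
  assumes "Poly_Mapping.keys c \<subseteq> S" "\<And>x. x \<in> S \<Longrightarrow> frag_extend f (g x) = h x"
  shows "frag_extend f (frag_extend g c) = frag_extend h c"
  using assms(1) by (induction c rule: frag_induction) (auto simp: frag_extend_diff assms(2))

text \<open>By freeness a congruence modulo \<open>J\<close> is checked on basis elements. Only
  closure under differences is asked of \<open>J\<close>, so images of subgroups can be used as bare
  sets.\<close>

lemma frag_diff_extend_mem:
  assumes "Poly_Mapping.keys c \<subseteq> S" "\<And>x. x \<in> S \<Longrightarrow> frag_of x - f x \<in> J"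
    and "0 \<in> J" "\<And>a b. a \<in> J \<Longrightarrow> b \<in> J \<Longrightarrow> a - b \<in> J"
  shows "c - frag_extend f c \<in> J"
  using assms(1)
proof (induction c rule: frag_induction)
  case (diff a b)
  have "a - b - frag_extend f (a - b) = (a - frag_extend f a) - (b - frag_extend f b)"
    by (simp add: frag_extend_diff)
  then show ?case
    using diff assms(4) by metis
qed (use assms in auto)

text \<open>Modulo the relations \<open>m = q m\<close>, the free abelian group on \<open>S\<close> becomes free on \<open>S - M\<close>: \<open>f\<close> is the
  projection, and the last conjunct, for \<open>J\<close> the subgroup of relations, bounds its kernel.\<close>

lemma elimination:
  fixes S M :: "'a set" and q :: "'a \<Rightarrow> 'a \<Rightarrow>\<^sub>0 int"
  assumes "wf R"
    and q: "\<And>m. m \<in> M \<Longrightarrow> Poly_Mapping.keys (q m) \<subseteq> S"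
    and less: "\<And>m s. m \<in> M \<Longrightarrow> s \<in> Poly_Mapping.keys (q m) \<Longrightarrow> s \<in> M \<Longrightarrow> (s, m) \<in> R"
  shows "\<exists>f. (\<forall>s\<in>S. Poly_Mapping.keys (f s) \<subseteq> S - M) \<and> (\<forall>s. s \<notin> M \<longrightarrow> f s = frag_of s) \<and>
    (\<forall>m\<in>M. f m = frag_extend f (q m)) \<and>
    (\<forall>J s. 0 \<in> J \<longrightarrow> (\<forall>a\<in>J. \<forall>b\<in>J. a - b \<in> J) \<longrightarrow> (\<forall>m\<in>M. frag_of m - q m \<in> J) \<longrightarrow> frag_of s - f s \<in> J)"
proof -
  \<comment> \<open>The guard \<open>t \<in> M\<close> confines recursive calls to generators still
    to be eliminated; there \<open>less\<close> gives the descent in \<open>R\<close>, so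
    \<open>cut\<close> does not change the value.\<close>
  define F where
    "F = (\<lambda>f s. if s \<in> M then frag_extend (\<lambda>t. if t \<in> M then f t else frag_of t) (q s) else frag_of s)"
  define f where "f = wfrec R F"
  have f_eq: "f s = F f s" for s
  proof -
    have "F (cut f R s) s = F f s"
    proof (cases "s \<in> M")
      case True
      have "(if t \<in> M then cut f R s t else frag_of t) = (if t \<in> M then f t else frag_of t)"
        if "t \<in> Poly_Mapping.keys (q s)" for t
        using less[OF True that] by (simp add: cut_apply)
      then show ?thesis
        using True by (auto simp: F_def intro: frag_extend_eq)
    qed (simp add: F_def)
    then show ?thesis
      using wfrec[OF \<open>wf R\<close>, of F s] by (simp add: f_def)
  qed
  show ?thesis
  proof (intro exI[of _ f] conjI ballI allI impI)
    show f1: "f s = frag_of s" if "s \<notin> M" for s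
      using f_eq[of s] that by (simp add: F_def)
    show f2: "f m = frag_extend f (q m)" if "m \<in> M" for m
      using f_eq[of m] that f1 by (auto simp: F_def intro: frag_extend_eq)
    show "Poly_Mapping.keys (f s) \<subseteq> S - M" if "s \<in> S" for s
      using \<open>wf R\<close> that
    proof (induction s rule: wf_induct_rule)
      case (less s)
      show ?case
      proof (cases "s \<in> M")
        case True
        have "Poly_Mapping.keys (f t) \<subseteq> S - M" if "t \<in> Poly_Mapping.keys (q s)" for t
          using that q[OF True] less assms(3)[OF True that] f1[of t]
          by (cases "t \<in> M") auto
        then show ?thesis
          using f2[OF True] keys_frag_extend[of f "q s"] by fastforce
      qed (use f1 less in auto)
    qed
    show "frag_of s - f s \<in> J"
      if J: "0 \<in> J" "\<forall>a\<in>J. \<forall>b\<in>J. a - b \<in> J" "\<forall>m\<in>M. frag_of m - q m \<in> J" for J s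
      using \<open>wf R\<close>
    proof (induction s rule: wf_induct_rule)
      case (less s)
      show ?case
      proof (cases "s \<in> M")
        case True
        have "q s - frag_extend f (q s) \<in> J"
        proof (rule frag_diff_extend_mem[OF order_refl])
          show "frag_of t - f t \<in> J" if "t \<in> Poly_Mapping.keys (q s)" for t
            using less assms(3)[OF True that] f1[of t] J(1) by (cases "t \<in> M") auto
        qed (use J in auto)
        then have "(frag_of s - q s) - (0 - (q s - frag_extend f (q s))) \<in> J"
          using J True by blast
        then show ?thesis
          by (simp add: f2[OF True])
      qed (use f1 J in auto)
    qed
  qed
qed

context rooted_graph
begin

section \<open>Generators and relations of the cokernel\<close>

abbreviation "A \<equiv> arcs (bigraph G)"

definition out_sum :: "'v \<Rightarrow> ('e \<times> bool) \<Rightarrow>\<^sub>0 int" where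
  "out_sum v = (\<Sum>x | x \<in> A \<and> src G x = v. frag_of x)"

definition bh_image :: "(('e \<times> bool) \<Rightarrow>\<^sub>0 int) set" where
  "bh_image = (\<lambda>c. c - bass_hashimoto G c) ` carrier (free_Abelian_group A)"

lemma bass_hashimoto_frag_of:
  "frag_of x - bass_hashimoto G (frag_of x) = frag_of x + frag_of (rev_arc x) - out_sum (tgt G x)"
  by (simp add: bass_hashimoto_def out_sum_def)

lemma bh_image_0: "0 \<in> bh_image"
  unfolding bh_image_def by (rule image_eqI[of _ _ 0]) (auto simp: bass_hashimoto_def)

lemma bh_image_diff: "a \<in> bh_image \<Longrightarrow> b \<in> bh_image \<Longrightarrow> a - b \<in> bh_image"
proof -
  assume "a \<in> bh_image" "b \<in> bh_image"
  then obtain c d where cd: "a = c - bass_hashimoto G c" "b = d - bass_hashimoto G d"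
    "Poly_Mapping.keys c \<subseteq> A" "Poly_Mapping.keys d \<subseteq> A"
    by (auto simp: bh_image_def)
  have "a - b = (c - d) - bass_hashimoto G (c - d)"
    by (simp add: cd bass_hashimoto_def frag_extend_diff)
  moreover have "Poly_Mapping.keys (c - d) \<subseteq> A"
    using cd keys_diff[of c d] by blast
  ultimately show ?thesis
    by (auto simp: bh_image_def)
qed

lemma bh_image_add: "a \<in> bh_image \<Longrightarrow> b \<in> bh_image \<Longrightarrow> a + b \<in> bh_image"
  using bh_image_diff[of a "0 - b"] bh_image_diff[OF bh_image_0] by simp

lemma relation_in_bh_image:
  assumes "x \<in> A"
  shows "frag_of x + frag_of (rev_arc x) - out_sum (tgt G x) \<in> bh_image"
  unfolding bh_image_def by (rule image_eqI[of _ _ "frag_of x"]) (use assms bass_hashimoto_frag_of in auto)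

text \<open>The image elements of an arc and of its reverse contain the same sum of the two arcs, so
  their difference compares the outgoing sums at the two ends. Along parent arcs this comparison
  reaches the root.\<close>

lemma out_sum_root:
  assumes "v \<in> V"
  shows "out_sum v - out_sum r \<in> bh_image"
  using assms
proof (induction "dist v" arbitrary: v)
  case 0
  then show ?case using dist_eq_0 bh_image_0 by force
next
  case (Suc n)
  then have v: "v \<in> V - {r}"
    using root by auto
  have "out_sum (par v) - out_sum r \<in> bh_image"
    using Suc dist_par[OF v] par_in_V[OF v] by simp
  moreover have "frag_of (pa v) + frag_of (rev_arc (pa v)) - out_sum v \<in> bh_image"
    "frag_of (rev_arc (pa v)) + frag_of (pa v) - out_sum (par v) \<in> bh_image"
    using relation_in_bh_image[of "pa v"] relation_in_bh_image[of "rev_arc (pa v)"] pa_arc[OF v] tgt_pa[OF v]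
      src_pa[OF v] by simp_all
  then have "(frag_of (rev_arc (pa v)) + frag_of (pa v) - out_sum (par v)) -
      (frag_of (pa v) + frag_of (rev_arc (pa v)) - out_sum v) \<in> bh_image"
    by (rule bh_image_diff[rotated])
  ultimately have "(out_sum (par v) - out_sum r) +
      ((frag_of (rev_arc (pa v)) + frag_of (pa v) - out_sum (par v)) -
      (frag_of (pa v) + frag_of (rev_arc (pa v)) - out_sum v)) \<in> bh_image"
    by (rule bh_image_add)
  then show ?case
    by (simp add: algebra_simps)
qed

lemma arc_pairs_in_bh_image:
  assumes "x \<in> A" "y \<in> A"
  shows "(frag_of x + frag_of (rev_arc x)) - (frag_of y + frag_of (rev_arc y)) \<in> bh_image"
proof -
  have *: "frag_of x + frag_of (rev_arc x) - out_sum r \<in> bh_image" if "x \<in> A" for x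
    using bh_image_add[OF relation_in_bh_image[OF that] out_sum_root[OF wf_mgraph_arc_ends(2)[OF wf that]]]
    by simp
  show ?thesis
    using bh_image_diff[OF *[OF assms(1)] *[OF assms(2)]] by simp
qed

text \<open>The arc in reduced generators: \<open>Inl e\<close> is the chord in its stored
  orientation, \<open>Inr v\<close> the parent arc of \<open>v\<close>. No parent arc enters the
  root, so \<open>Inr r\<close> is available for the common value of \<open>x + rev x\<close>;
  reversing an arc subtracts its class from it.\<close>

definition arc_class :: "'e \<times> bool \<Rightarrow> ('e + 'v) \<Rightarrow>\<^sub>0 int" where
  "arc_class x =
    (if fst x \<in> chords then
       if snd x then frag_of (Inl (fst x)) else frag_of (Inr r) - frag_of (Inl (fst x))
     else if tgt G x \<noteq> r \<and> x = pa (tgt G x) then frag_of (Inr (tgt G x))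
     else frag_of (Inr r) - frag_of (Inr (src G x)))"

text \<open>This is \<open>Inr r\<close> minus the sum of the classes of the arcs leaving
  \<open>v\<close>, after cancelling: the reversed parent arc contributes
  \<open>Inr r - Inr v\<close>.\<close>

definition vertex_rel :: "'v \<Rightarrow> ('e + 'v) \<Rightarrow>\<^sub>0 int" where
  "vertex_rel v = frag_of (Inr v) - (\<Sum>w\<in>children v. frag_of (Inr w)) -
    (\<Sum>x | x \<in> A \<and> src G x = v \<and> fst x \<in> chords. arc_class x)"

lemma pa_not_chord: "v \<in> V - {r} \<Longrightarrow> fst (pa v) \<notin> chords"
  using pa_tree by (auto simp: chords_def)

lemma arc_class_pa: "v \<in> V - {r} \<Longrightarrow> arc_class (pa v) = frag_of (Inr v)"
  using tgt_pa[of v] pa_not_chord[of v] by (simp add: arc_class_def)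

lemma arc_class_rev_pa:
  assumes "v \<in> V - {r}"
  shows "arc_class (rev_arc (pa v)) = frag_of (Inr r) - frag_of (Inr v)"
proof -
  have "par v \<noteq> r \<Longrightarrow> rev_arc (pa v) \<noteq> pa (par v)"
    using pa_not_rev[of "par v" v] par_in_V assms by (metis Diff_iff singletonD)
  then show ?thesis
    using src_pa[OF assms] tgt_pa[OF assms] pa_not_chord[OF assms] by (auto simp: arc_class_def)
qed

lemma arc_class_rev:
  assumes "x \<in> A"
  shows "arc_class x + arc_class (rev_arc x) = frag_of (Inr r)"
  using assms
proof (cases rule: arc_cases)
  case chord
  then show ?thesis by (cases "snd x") (auto simp: arc_class_def rev_arc_def)
qed (auto simp: arc_class_pa arc_class_rev_pa)

text \<open>The arcs leaving \<open>v\<close> are chords, parent arcs of children and, for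
  \<open>v \<noteq> r\<close>, the reversed parent arc. At the root the latter is absent, but its
  value \<open>Inr r - Inr v\<close> would be \<open>0\<close>, so the formula is uniform.\<close>

lemma sum_arc_class:
  assumes v: "v \<in> V"
  shows "(\<Sum>x | x \<in> A \<and> src G x = v. arc_class x) = frag_of (Inr r) - vertex_rel v"
proof -
  define C where "C = {x \<in> A. src G x = v \<and> fst x \<in> chords}"
  define U where "U = (if v = r then {} else {rev_arc (pa v)})"
  have fin: "finite {x \<in> A. src G x = v}"
    by (rule locally_finite_arcs(1)[OF loc_fin v])
  have eq: "{x \<in> A. src G x = v} = C \<union> (pa ` children v \<union> U)"
  proof (intro equalityI subsetI)
    fix x assume x: "x \<in> {x \<in> A. src G x = v}"
    then have "x \<in> A" by simp
    then show "x \<in> C \<union> (pa ` children v \<union> U)"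
    proof (cases rule: arc_cases)
      case (down w)
      then show ?thesis using x src_pa[of w] by (auto simp: children_def)
    next
      case (up w)
      then show ?thesis using x tgt_pa[of w] by (auto simp: U_def)
    qed (use x in \<open>auto simp: C_def\<close>)
  next
    fix x assume "x \<in> C \<union> (pa ` children v \<union> U)"
    then consider "x \<in> C" | w where "w \<in> V - {r}" "par w = v" "x = pa w" | "v \<noteq> r" "x = rev_arc (pa v)"
      by (auto simp: U_def children_def split: if_splits)
    then show "x \<in> {x \<in> A. src G x = v}"
      using pa_arc src_pa tgt_pa v by cases (auto simp: C_def)
  qed
  have disj: "C \<inter> (pa ` children v \<union> U) = {}" "pa ` children v \<inter> U = {}"
    using pa_not_chord pa_not_rev[of _ v] v by (force simp: C_def U_def children_def)+
  have inj: "inj_on pa (children v)"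
    using fst_pa_inj by (auto simp: inj_on_def children_def)
  have finU: "finite C" "finite (pa ` children v)" "finite U"
    using fin by (auto simp: eq)
  have "(\<Sum>x | x \<in> A \<and> src G x = v. arc_class x) =
      (\<Sum>x\<in>C. arc_class x) + ((\<Sum>x\<in>pa ` children v. arc_class x) + (\<Sum>x\<in>U. arc_class x))"
    unfolding eq using finU disj by (simp add: sum.union_disjoint)
  also have "(\<Sum>x\<in>pa ` children v. arc_class x) = (\<Sum>w\<in>children v. frag_of (Inr w))"
    using arc_class_pa by (subst sum.reindex[OF inj]) (auto intro!: sum.cong simp: children_def)
  also have "(\<Sum>x\<in>U. arc_class x) = frag_of (Inr r) - frag_of (Inr v)"
    using v by (auto simp: U_def arc_class_rev_pa)
  finally show ?thesis
    by (simp add: vertex_rel_def C_def)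
qed

text \<open>The pair \<open>x + rev x\<close> has become the constant \<open>Inr r\<close>, so only
  the target matters and all arcs into a vertex yield the same relation.\<close>

lemma extend_arc_class_relation:
  assumes "x \<in> A"
  shows "frag_extend arc_class (frag_of x - bass_hashimoto G (frag_of x)) = vertex_rel (tgt G x)"
proof -
  have v: "tgt G x \<in> V"
    by (rule wf_mgraph_arc_ends(2)[OF wf assms])
  have "frag_extend arc_class (out_sum (tgt G x)) = frag_of (Inr r) - vertex_rel (tgt G x)"
    unfolding out_sum_def sum_arc_class[OF v, symmetric]
    by (subst frag_extend_sum[OF locally_finite_arcs(1)[OF loc_fin v]]) simp
  then show ?thesis
    using arc_class_rev[OF assms] unfolding bass_hashimoto_frag_of
    by (simp add: frag_extend_diff frag_extend_add)
qed

text \<open>The map \<open>g\<close> lifts reduced generators to arcs, with \<open>Inr r\<close>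
  lifted to \<open>a + rev a\<close> for some tree arc \<open>a\<close>. Applying
  \<open>arc_class\<close> and then \<open>g\<close> changes an arc only by \<open>bh_image\<close>,
  so a \<open>c\<close> with trivial class lies in \<open>bh_image\<close>.\<close>

lemma kernel_arc_class:
  assumes "Poly_Mapping.keys c \<subseteq> A" "frag_extend arc_class c = 0"
  shows "c \<in> bh_image"
proof -
  have "infinite (V - {r})"
    using inf_vertices by simp
  then obtain v where v: "v \<in> V - {r}"
    using infinite_imp_nonempty by blast
  define a where "a = pa v"
  have a: "a \<in> A"
    using pa_arc[OF v] by (simp add: a_def)
  define g where "g = (\<lambda>s. case s of Inl e \<Rightarrow> frag_of (e, True)
    | Inr v \<Rightarrow> if v = r then frag_of a + frag_of (rev_arc a) else frag_of (pa v))"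
  have "frag_of x - frag_extend g (arc_class x) \<in> bh_image" if "x \<in> A" for x
    using that
  proof (cases rule: arc_cases)
    case chord
    show ?thesis
    proof (cases "snd x")
      case True
      then obtain e where "x = (e, True)"
        by (cases x) auto
      then show ?thesis
        using chord bh_image_0 by (simp add: arc_class_def g_def)
    next
      case False
      then obtain e where "x = (e, False)"
        by (cases x) auto
      then have "frag_of x - frag_extend g (arc_class x) =
          (frag_of x + frag_of (rev_arc x)) - (frag_of a + frag_of (rev_arc a))"
        using chord by (simp add: arc_class_def g_def frag_extend_diff rev_arc_def)
      then show ?thesis using arc_pairs_in_bh_image[OF that a] by argo
    qed
  next
    case (down w)
    then show ?thesis using bh_image_0 by (auto simp: arc_class_pa g_def)
  next
    case (up w)
    then have "frag_of x - frag_extend g (arc_class x) =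
        (frag_of x + frag_of (rev_arc x)) - (frag_of a + frag_of (rev_arc a))"
      by (auto simp: arc_class_rev_pa g_def frag_extend_diff)
    then show ?thesis using arc_pairs_in_bh_image[OF that a] by argo
  qed
  then have "c - frag_extend (\<lambda>x. frag_extend g (arc_class x)) c \<in> bh_image"
    by (rule frag_diff_extend_mem[OF assms(1) _ bh_image_0 bh_image_diff])
  moreover have "frag_extend (\<lambda>x. frag_extend g (arc_class x)) c = frag_extend g (frag_extend arc_class c)"
    by (rule frag_extend_eq_comp[OF order_refl, symmetric]) simp
  ultimately show ?thesis
    by (simp add: assms(2))
qed


section \<open>Solving the vertex relations\<close>

definition gens :: "('e + 'v) set" where "gens = Inl ` chords \<union> Inr ` V"

definition solved :: "('e + 'v) set" where "solved = Inr ` (V - ray_starts)"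

text \<open>The signs differ because a solved \<open>Inr w\<close> has coefficient -1 in the
  relation at its parent, used if \<open>w\<close> is live, and +1 in the relation at
  \<open>w\<close>. Chords are never solved for; their value \<open>0\<close> is a default.\<close>

definition solution :: "'e + 'v \<Rightarrow> ('e + 'v) \<Rightarrow>\<^sub>0 int" where
  "solution s = (case s of Inl e \<Rightarrow> 0
    | Inr w \<Rightarrow> if live w then frag_of (Inr w) + vertex_rel (par w) else frag_of (Inr w) - vertex_rel w)"

lemma gens_minus_solved: "gens - solved = Inl ` chords \<union> Inr ` ray_starts"
  by (auto simp: gens_def solved_def ray_starts_def live_def)

lemma keys_diff_diff: "Poly_Mapping.keys (a - b - c) \<subseteq> Poly_Mapping.keys a \<union> Poly_Mapping.keys b \<union> Poly_Mapping.keys c"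
  for a b c :: "'a \<Rightarrow>\<^sub>0 int"
  using keys_diff[of "a - b" c] keys_diff[of a b] by blast

text \<open>Reversed chords bring in \<open>Inr r\<close> at any vertex. This creates no cycle of
  substitutions, since \<open>r\<close> is a ray start and hence not solved.\<close>

lemma keys_arc_class_chord: "fst x \<in> chords \<Longrightarrow> Poly_Mapping.keys (arc_class x) \<subseteq> Inl ` chords \<union> {Inr r}"
  using keys_diff[of "frag_of (Inr r)" "frag_of (Inl (fst x))"] by (auto simp: arc_class_def)

lemma keys_arc_class: "x \<in> A \<Longrightarrow> Poly_Mapping.keys (arc_class x) \<subseteq> gens"
  using keys_diff[of "frag_of (Inr r)" "frag_of (Inl (fst x))"] root(1)
    keys_diff[of "frag_of (Inr r)" "frag_of (Inr (src G x))"] wf_mgraph_arc_ends[OF wf, of x]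
  by (auto simp: arc_class_def gens_def)

lemma keys_vertex_rel:
  assumes "v \<in> V"
  shows "Poly_Mapping.keys (frag_of (Inr v) - vertex_rel v) \<subseteq> Inl ` chords \<union> {Inr r} \<union> Inr ` children v"
proof -
  have "frag_of (Inr v) - vertex_rel v = (\<Sum>w\<in>children v. frag_of (Inr w)) +
      (\<Sum>x | x \<in> A \<and> src G x = v \<and> fst x \<in> chords. arc_class x)"
    by (simp add: vertex_rel_def)
  moreover have "Poly_Mapping.keys (\<Sum>w\<in>children v. frag_of (Inr w) :: ('e + 'v) \<Rightarrow>\<^sub>0 int) \<subseteq> Inr ` children v"
    by (rule order_trans[OF keys_sum]) auto
  moreover have "Poly_Mapping.keys (\<Sum>x | x \<in> A \<and> src G x = v \<and> fst x \<in> chords. arc_class x) \<subseteq> Inl ` chords \<union> {Inr r}"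
    by (rule order_trans[OF keys_sum]) (auto dest!: keys_arc_class_chord)
  ultimately show ?thesis
    using keys_add[of "\<Sum>w\<in>children v. frag_of (Inr w :: 'e + 'v)"
        "\<Sum>x | x \<in> A \<and> src G x = v \<and> fst x \<in> chords. arc_class x"] by auto
qed

text \<open>Solving the relation at \<open>v\<close> for \<open>pc v\<close> if \<open>v\<close> is live, and for \<open>v\<close> itself otherwise; this order
  goes down the rays and up the finite subtrees.\<close>

definition solving_order :: "(('e + 'v) \<times> ('e + 'v)) set" where
  "solving_order = inv_image (less_than <*lex*> less_than)
    (\<lambda>s. case s of Inl e \<Rightarrow> (0, 0) | Inr w \<Rightarrow> if live w then (1, dist w) else (0, card (desc w)))"

lemma live_solved: "w \<in> V - ray_starts \<Longrightarrow> live w \<Longrightarrow> live (par w) \<and> pc (par w) = w \<and> w \<in> V - {r}"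
  using par_pc pc_in by (auto simp: ray_starts_def)

text \<open>For live \<open>w\<close> there occur the parent, which is live and closer to the root,
  and the siblings: a live sibling is not preferred, hence an unsolved ray start, and the others
  belong to the lower block of the order. For other \<open>w\<close> the children have strictly
  smaller finite subtrees.\<close>

lemma keys_solution:
  assumes w: "w \<in> V - ray_starts" and s: "s \<in> Poly_Mapping.keys (solution (Inr w))"
  shows "s \<in> gens" "s \<in> solved \<Longrightarrow> (s, Inr w) \<in> solving_order"
proof -
  have wV: "w \<in> V" "w \<noteq> r"
    using w root_ray_start by auto
  have "s \<in> gens \<and> (s \<in> solved \<longrightarrow> (s, Inr w) \<in> solving_order)"
  proof (cases "live w")
    case True
    then have p: "live (par w)" "pc (par w) = w" "par w \<in> V"
      using live_solved[OF w] par_in_V by auto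
    define rest where "rest = (\<Sum>u\<in>children (par w) - {w}. frag_of (Inr u :: 'e + 'v))"
    define ch where "ch = (\<Sum>x | x \<in> A \<and> src G x = par w \<and> fst x \<in> chords. arc_class x)"
    have wc: "w \<in> children (par w)"
      using wV by (simp add: children_def)
    have "(\<Sum>u\<in>children (par w). frag_of (Inr u :: 'e + 'v)) = frag_of (Inr w) + rest"
      unfolding rest_def by (rule sum.remove[OF finite_children[OF p(3)] wc])
    then have sol: "solution (Inr w) = frag_of (Inr (par w)) - rest - ch"
      using True by (simp add: solution_def vertex_rel_def ch_def)
    have "Poly_Mapping.keys rest \<subseteq> Inr ` (children (par w) - {w})"
      unfolding rest_def by (rule order_trans[OF keys_sum]) auto
    moreover have "Poly_Mapping.keys ch \<subseteq> Inl ` chords \<union> {Inr r}"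
      unfolding ch_def by (rule order_trans[OF keys_sum]) (auto dest!: keys_arc_class_chord)
    moreover have "s \<in> {Inr (par w)} \<union> Poly_Mapping.keys rest \<union> Poly_Mapping.keys ch"
      using keys_diff_diff[of "frag_of (Inr (par w))" rest ch] s
      unfolding sol keys_frag_of by (rule subsetD)
    ultimately have "s \<in> {Inr (par w)} \<union> Inr ` (children (par w) - {w}) \<union> (Inl ` chords \<union> {Inr r})"
      by blast
    then consider "s = Inr (par w)" | u where "u \<in> children (par w)" "u \<noteq> w" "s = Inr u"
      | "s \<in> Inl ` chords \<union> {Inr r}"
      by auto
    then show ?thesis
    proof cases
      case 1
      then show ?thesis
        using p True dist_par[of w] wV by (auto simp: gens_def solving_order_def)
    next
      case (2 u)
      have "\<not> live u" if "u \<notin> ray_starts"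
        using live_solved[of u] that 2 p(2) by (auto simp: children_def)
      then show ?thesis
        using 2 True by (auto simp: gens_def solving_order_def solved_def children_def)
    next
      case 3
      then show ?thesis
        using root(1) root_ray_start by (auto simp: gens_def solved_def)
    qed
  next
    case False
    then have "s \<in> Inl ` chords \<union> {Inr r} \<union> Inr ` children w"
      using s keys_vertex_rel[OF wV(1)] by (auto simp: solution_def)
    then consider "s \<in> Inl ` chords \<union> {Inr r}" | u where "u \<in> children w" "s = Inr u"
      by auto
    then show ?thesis
    proof cases
      case 1
      then show ?thesis
        using root(1) root_ray_start by (auto simp: gens_def solved_def)
    next
      case (2 u)
      then have u: "u \<in> V - {r}" "par u = w"
        by (auto simp: children_def)
      have "desc u \<subseteq> desc w"
        using desc_children[OF wV(1)] 2 by auto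
      moreover have "w \<notin> desc u"
        using dist_par[OF u(1)] u(2) by (simp add: desc_def)
      ultimately have "desc u \<subset> desc w"
        using self_in_desc[OF wV(1)] by auto
      then have "card (desc u) < card (desc w)"
        using False wV by (simp add: psubset_card_mono live_def)
      moreover have "\<not> live u"
        using live_par[OF 2(1) _ wV(1)] False by blast
      ultimately show ?thesis
        using u 2 False by (auto simp: gens_def solving_order_def)
    qed
  qed
  then show "s \<in> gens" "s \<in> solved \<Longrightarrow> (s, Inr w) \<in> solving_order"
    by auto
qed

lemma bass_hashimoto_diff:
  "(a - b) - bass_hashimoto G (a - b) = (a - bass_hashimoto G a) - (b - bass_hashimoto G b)"
  by (simp add: bass_hashimoto_def frag_extend_diff)

lemma keys_bh_image:
  assumes "c \<in> bh_image"
  shows "Poly_Mapping.keys c \<subseteq> A"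
proof -
  have out: "Poly_Mapping.keys (out_sum v) \<subseteq> A" for v
    unfolding out_sum_def by (rule order_trans[OF keys_sum]) auto
  obtain d where d: "Poly_Mapping.keys d \<subseteq> A" "c = d - bass_hashimoto G d"
    using assms by (auto simp: bh_image_def)
  have "Poly_Mapping.keys (d - bass_hashimoto G d) \<subseteq> A"
    using d(1)
  proof (induction d rule: frag_induction)
    case zero
    then show ?case by (simp add: bass_hashimoto_def)
  next
    case (one x)
    have "Poly_Mapping.keys (frag_of x + frag_of (rev_arc x)) \<subseteq> A"
      using keys_add[of "frag_of x" "frag_of (rev_arc x)"] one by auto
    then show ?case
      using keys_diff[of "frag_of x + frag_of (rev_arc x)" "out_sum (tgt G x)"] out[of "tgt G x"]
      unfolding bass_hashimoto_frag_of by blast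
  next
    case (diff a b)
    then show ?case
      using keys_diff[of "a - bass_hashimoto G a" "b - bass_hashimoto G b"]
      unfolding bass_hashimoto_diff by blast
  qed
  then show ?thesis
    by (simp add: d(2))
qed

text \<open>The composite \<open>\<phi>\<close> of \<open>arc_class\<close> with the elimination map
  is onto the free group on the unsolved generators and has kernel \<open>bh_image\<close>; the
  first isomorphism theorem applies.\<close>

lemma K0_free: "K0 G \<cong> free_Abelian_group (Inl ` chords \<union> Inr ` ray_starts)"
proof -
  have 1: "wf solving_order"
    unfolding solving_order_def by (intro wf_inv_image wf_lex_prod wf_less_than)
  have 2: "Poly_Mapping.keys (solution m) \<subseteq> gens" if "m \<in> solved" for m
    using that keys_solution(1) by (auto simp: solved_def)
  have 3: "(s, m) \<in> solving_order" if "m \<in> solved" "s \<in> Poly_Mapping.keys (solution m)" "s \<in> solved" for m s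
    using that keys_solution(2) by (auto simp: solved_def)
  have "\<exists>f. (\<forall>s\<in>gens. Poly_Mapping.keys (f s) \<subseteq> gens - solved) \<and> (\<forall>s. s \<notin> solved \<longrightarrow> f s = frag_of s) \<and>
    (\<forall>m\<in>solved. f m = frag_extend f (solution m)) \<and>
    (\<forall>J s. 0 \<in> J \<longrightarrow> (\<forall>a\<in>J. \<forall>b\<in>J. a - b \<in> J) \<longrightarrow> (\<forall>m\<in>solved. frag_of m - solution m \<in> J) \<longrightarrow>
      frag_of s - f s \<in> J)"
    by (rule elimination[of solving_order solved solution gens]) (use 1 2 3 in auto)
  then obtain f where f: "\<forall>s\<in>gens. Poly_Mapping.keys (f s) \<subseteq> gens - solved"
    "\<forall>s. s \<notin> solved \<longrightarrow> f s = frag_of s" "\<forall>m\<in>solved. f m = frag_extend f (solution m)"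
    and f_mod: "\<forall>J s. 0 \<in> J \<longrightarrow> (\<forall>a\<in>J. \<forall>b\<in>J. a - b \<in> J) \<longrightarrow>
      (\<forall>m\<in>solved. frag_of m - solution m \<in> J) \<longrightarrow> frag_of s - f s \<in> J"
    by (elim exE conjE)
  \<comment> \<open>The relation at \<open>v\<close> was spent on one generator, \<open>pc v\<close>
    or \<open>v\<close>, and the recursion equation of \<open>f\<close> at that generator says that
    the relation goes to zero.\<close>
  have f_rel: "frag_extend f (vertex_rel v) = 0" if "v \<in> V" for v
  proof (cases "live v")
    case True
    then have "Inr (pc v) \<in> solved" "live (pc v)" "par (pc v) = v"
      using pc_in live_pc par_pc by (auto simp: solved_def ray_starts_def)
    then have "f (Inr (pc v)) = frag_extend f (solution (Inr (pc v)))"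
      "solution (Inr (pc v)) = frag_of (Inr (pc v)) + vertex_rel v"
      using f(3) by (blast, simp add: solution_def)
    then show ?thesis
      by (metis add_cancel_left_right frag_extend_add frag_extend_of)
  next
    case False
    then have "Inr v \<in> solved"
      using that by (auto simp: solved_def ray_starts_def)
    then have "f (Inr v) = frag_extend f (solution (Inr v))"
      "solution (Inr v) = frag_of (Inr v) - vertex_rel v"
      using f(3) False by (blast, simp add: solution_def)
    then show ?thesis
      by (metis diff_eq_eq add_cancel_left_right frag_extend_diff frag_extend_of)
  qed
  define \<phi> where "\<phi> c = frag_extend f (frag_extend arc_class c)" for c
  let ?A = "free_Abelian_group A" and ?B = "free_Abelian_group (gens - solved)"
  have \<phi>_diff: "\<phi> (a - b) = \<phi> a - \<phi> b" and \<phi>_add: "\<phi> (a + b) = \<phi> a + \<phi> b" for a b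
    by (simp_all add: \<phi>_def frag_extend_diff frag_extend_add)
  have keys_\<phi>: "Poly_Mapping.keys (\<phi> c) \<subseteq> gens - solved" if "Poly_Mapping.keys c \<subseteq> A" for c
  proof -
    have "Poly_Mapping.keys (frag_extend arc_class c) \<subseteq> gens"
      using keys_frag_extend[of arc_class c] keys_arc_class that by blast
    then show ?thesis
      using keys_frag_extend[of f "frag_extend arc_class c"] f(1) unfolding \<phi>_def by blast
  qed
  have hom: "\<phi> \<in> hom ?A ?B"
    using keys_\<phi> by (auto simp: hom_def \<phi>_add)
  have kernel_eq: "kernel ?A ?B \<phi> = bh_image"
  proof (intro equalityI subsetI)
    fix c assume "c \<in> kernel ?A ?B \<phi>"
    then have c: "Poly_Mapping.keys c \<subseteq> A" "\<phi> c = 0"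
      by (auto simp: kernel_def)
    \<comment> \<open>Reducing \<open>arc_class c\<close> by \<open>f\<close> changes it only by an
      element of \<open>J\<close>. So \<open>\<phi> c = 0\<close> gives a relation \<open>i\<close>
      with the same class as \<open>c\<close>, and \<open>kernel_arc_class\<close> applies to
      \<open>c - i\<close>.\<close>
    define J where "J = frag_extend arc_class ` bh_image"
    have J: "0 \<in> J" "\<And>a b. a \<in> J \<Longrightarrow> b \<in> J \<Longrightarrow> a - b \<in> J"
    proof -
      show "0 \<in> J"
        unfolding J_def using bh_image_0 by (intro image_eqI[of _ _ 0]) auto
      show "a - b \<in> J" if ab: "a \<in> J" "b \<in> J" for a b
      proof -
        obtain c d where "a = frag_extend arc_class c" "b = frag_extend arc_class d" "c \<in> bh_image" "d \<in> bh_image"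
          using ab by (auto simp: J_def)
        then show ?thesis
          unfolding J_def using bh_image_diff[of c d] by (intro image_eqI[of _ _ "c - d"]) (auto simp: frag_extend_diff)
      qed
    qed
    have rel: "vertex_rel v \<in> J" if "v \<in> V" for v
    proof -
      \<comment> \<open>Any arc into \<open>v\<close> produces the relation at \<open>v\<close>; the
        root is entered by the reversed parent arc of a child.\<close>
      obtain x where "x \<in> A" "tgt G x = v"
      proof (cases "v = r")
        case True
        obtain w where "w \<in> children r"
          using live_child[OF live_root] by auto
        then show ?thesis
          using that[of "rev_arc (pa w)"] True pa_arc src_pa by (auto simp: children_def)
      next
        case False
        then show ?thesis
          using that[of "pa v"] \<open>v \<in> V\<close> pa_arc tgt_pa by simp
      qed
      then show ?thesis
        using extend_arc_class_relation[of x] relation_in_bh_image[of x]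
        unfolding J_def bass_hashimoto_frag_of by (metis imageI)
    qed
    have "frag_of m - solution m \<in> J" if m: "m \<in> solved" for m
    proof -
      obtain w where w: "m = Inr w" "w \<in> V - ray_starts"
        using m by (auto simp: solved_def)
      show ?thesis
      proof (cases "live w")
        case True
        then have "0 - vertex_rel (par w) \<in> J"
          using live_solved[OF w(2)] par_in_V rel J by blast
        then show ?thesis
          using True w by (simp add: solution_def)
      next
        case False
        then show ?thesis
          using w rel by (simp add: solution_def)
      qed
    qed
    then have "frag_of s - f s \<in> J" for s
      using f_mod J by blast
    then have "frag_extend arc_class c - \<phi> c \<in> J"
      unfolding \<phi>_def by (rule frag_diff_extend_mem[OF order_refl _ J])
    then obtain i where i: "i \<in> bh_image" "frag_extend arc_class c = frag_extend arc_class i"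
      using c(2) by (auto simp: J_def)
    have "Poly_Mapping.keys i \<subseteq> A"
      by (rule keys_bh_image[OF i(1)])
    then have "Poly_Mapping.keys (c - i) \<subseteq> A"
      using c(1) keys_diff[of c i] by blast
    moreover have "frag_extend arc_class (c - i) = 0"
      using i by (simp add: frag_extend_diff)
    ultimately have "c - i \<in> bh_image"
      by (rule kernel_arc_class)
    then show "c \<in> bh_image"
      using bh_image_add[OF _ i(1)] by fastforce
  next
    fix c assume c: "c \<in> bh_image"
    then obtain d where d: "Poly_Mapping.keys d \<subseteq> A" "c = d - bass_hashimoto G d"
      by (auto simp: bh_image_def)
    have "\<phi> (d - bass_hashimoto G d) = 0"
      using d(1)
    proof (induction d rule: frag_induction)
      case zero
      then show ?case by (simp add: bass_hashimoto_def \<phi>_def)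
    next
      case (one x)
      show ?case
        using f_rel[of "tgt G x"] wf_mgraph_arc_ends(2)[OF wf one]
        unfolding \<phi>_def extend_arc_class_relation[OF one] by simp
    next
      case (diff a b)
      then show ?case
        by (simp add: bass_hashimoto_diff \<phi>_diff)
    qed
    then show "c \<in> kernel ?A ?B \<phi>"
      using keys_bh_image[OF c] by (simp add: kernel_def d(2))
  qed
  have surj: "\<phi> ` carrier ?A = carrier ?B"
  proof
    show "\<phi> ` carrier ?A \<subseteq> carrier ?B"
      using keys_\<phi> by auto
    have "c \<in> \<phi> ` carrier ?A" if "Poly_Mapping.keys c \<subseteq> gens - solved" for c
      using that
    proof (induction c rule: frag_induction)
      case zero
      then show ?case by (intro image_eqI[of _ _ 0]) (auto simp: \<phi>_def)
    next
      case (one s)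
      then have fs: "f s = frag_of s"
        using f(2) by blast
      obtain w where w: "w \<in> children r"
        using live_child[OF live_root] by auto
      consider e where "e \<in> chords" "s = Inl e" | "s = Inr r" | v where "v \<in> V - {r}" "s = Inr v"
        using one by (auto simp: gens_def)
      then show ?case
      proof cases
        case (1 e)
        then show ?thesis
          using fs by (intro image_eqI[of _ _ "frag_of (e, True)"])
            (auto simp: \<phi>_def arc_class_def arcs_bigraph chords_def)
      next
        case 2
        have "w \<in> V - {r}"
          using w by (simp add: children_def)
        then show ?thesis
          using fs 2 pa_arc[of w] keys_add[of "frag_of (pa w)" "frag_of (rev_arc (pa w))"]
          by (intro image_eqI[of _ _ "frag_of (pa w) + frag_of (rev_arc (pa w))"])
            (auto simp: \<phi>_def arc_class_pa arc_class_rev_pa frag_extend_diff frag_extend_add)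
      next
        case (3 v)
        then show ?thesis
          using fs pa_arc[of v] by (intro image_eqI[of _ _ "frag_of (pa v)"]) (auto simp: \<phi>_def arc_class_pa)
      qed
    next
      case (diff a b)
      then obtain a' b' where "a = \<phi> a'" "b = \<phi> b'" "Poly_Mapping.keys a' \<subseteq> A" "Poly_Mapping.keys b' \<subseteq> A"
        by auto
      then show ?case
        using keys_diff[of a' b'] by (intro image_eqI[of _ _ "a' - b'"]) (auto simp: \<phi>_diff)
    qed
    then show "carrier ?B \<subseteq> \<phi> ` carrier ?A"
      by auto
  qed
  have "group_hom ?A ?B \<phi>"
    by (simp add: group_hom_def group_hom_axioms_def hom)
  then have "?A Mod kernel ?A ?B \<phi> \<cong> ?B"
    by (rule group_hom.FactGroup_iso[OF _ surj])
  then show ?thesis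
    unfolding kernel_eq unfolding K0_def bh_image_def gens_minus_solved .
qed

end

section \<open>The contraction of the realization\<close>

text \<open>Presents the disjoint union of the unit intervals of the edges as a product with a
  discrete factor, so that theorems on products and quotient maps apply to the realization.\<close>

lemma openin_prod_discrete_topology:
  "openin (prod_topology (discrete_topology I) Y) U \<longleftrightarrow>
    U \<subseteq> I \<times> topspace Y \<and> (\<forall>i\<in>I. openin Y {y. (i, y) \<in> U})" (is "?lhs \<longleftrightarrow> ?rhs")
proof
  assume U: ?lhs
  have "\<exists>T. openin Y T \<and> y \<in> T \<and> T \<subseteq> {y. (i, y) \<in> U}" if iy: "(i, y) \<in> U" for i y
  proof -
    obtain S T where "openin Y T" "i \<in> S" "y \<in> T" "S \<times> T \<subseteq> U"
      using U[unfolded openin_prod_topology_alt, rule_format, OF iy] by auto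
    then show ?thesis
      by (intro exI[of _ T]) auto
  qed
  then have "openin Y {y. (i, y) \<in> U}" for i
    by (subst openin_subopen) blast
  then show ?rhs
    using openin_subset[OF U] by simp
next
  assume U: ?rhs
  have "\<exists>S T. openin (discrete_topology I) S \<and> openin Y T \<and> x \<in> S \<and> y \<in> T \<and> S \<times> T \<subseteq> U" if "(x, y) \<in> U" for x y
    using U that by (intro exI[of _ "{x}"] exI[of _ "{y. (x, y) \<in> U}"]) auto
  then show ?lhs
    unfolding openin_prod_topology_alt by blast
qed

lemma topspace_realization_char_map:
  "topspace (geometric_realization G) = Vertex ` vertices G \<union> (\<Union>e\<in>edges G. char_map G e ` {0..1})"
    (is "_ = ?S")
proof
  have "openin (geometric_realization G) (topspace (geometric_realization G))"
    by (rule openin_topspace)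
  then show "topspace (geometric_realization G) \<subseteq> ?S"
    unfolding openin_geometric_realization by (rule conjunct1)
  have "{t \<in> {0..1}. char_map G e t \<in> ?S} = {0..1}" if "e \<in> edges G" for e
    using that by auto
  then have "openin (geometric_realization G) ?S"
    unfolding openin_geometric_realization by auto
  then show "?S \<subseteq> topspace (geometric_realization G)"
    by (rule openin_subset)
qed

lemma topspace_geometric_realization:
  assumes "wf_mgraph G"
  shows "topspace (geometric_realization G) = Vertex ` vertices G \<union> {Inner e t |e t. e \<in> edges G \<and> 0 < t \<and> t < 1}"
    (is "_ = ?T")
proof -
  have V: "fst (orient G e) \<in> vertices G" "snd (orient G e) \<in> vertices G" if "e \<in> edges G" for e
    using wf_mgraph_arc_ends[OF assms, of "(e, True)"] that by (auto simp: arcs_bigraph src_eq tgt_eq)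
  have 1: "char_map G e ` {0..1} \<subseteq> ?T" if "e \<in> edges G" for e
    using that V[OF that] by (auto simp: char_map_def)
  have 2: "Inner e t \<in> char_map G e ` {0..1}" if "0 < t" "t < 1" for e t
    using that by (intro image_eqI[of _ _ t]) (auto simp: char_map_def)
  show ?thesis
    unfolding topspace_realization_char_map
  proof (intro equalityI Un_least UN_least)
    show "{Inner e t |e t. e \<in> edges G \<and> 0 < t \<and> t < 1} \<subseteq> Vertex ` vertices G \<union> (\<Union>e\<in>edges G. char_map G e ` {0..1})"
      using 2 by fastforce
  qed (use 1 in auto)
qed

lemma continuous_char_map:
  assumes "e \<in> edges G"
  shows "continuous_map (top_of_set {0..1}) (geometric_realization G) (char_map G e)"
  unfolding continuous_map_def
proof (intro conjI allI impI)
  have "char_map G e ` {0..1} \<subseteq> topspace (geometric_realization G)"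
    using assms unfolding topspace_realization_char_map by blast
  then show "char_map G e \<in> topspace (top_of_set {0..1}) \<rightarrow> topspace (geometric_realization G)"
    by auto
next
  fix U assume "openin (geometric_realization G) U"
  then show "openin (top_of_set {0..1}) {x \<in> topspace (top_of_set {0..1}). char_map G e x \<in> U}"
    using assms unfolding openin_geometric_realization by simp
qed

definition arc_map :: "('v, 'e) mgraph \<Rightarrow> 'e \<times> bool \<Rightarrow> real \<Rightarrow> ('v, 'e) realization_point" where
  "arc_map G x q = char_map G (fst x) (if snd x then q else 1 - q)"

lemma arc_map_0 [simp]: "arc_map G x 0 = Vertex (src G x)"
  and arc_map_1 [simp]: "arc_map G x 1 = Vertex (tgt G x)"
  by (cases x; simp add: arc_map_def char_map_def src_eq tgt_eq)+

lemma arc_map_Inner: "0 < q \<Longrightarrow> q < 1 \<Longrightarrow> arc_map G x q = Inner (fst x) (if snd x then q else 1 - q)"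
  by (simp add: arc_map_def char_map_def)

lemma continuous_arc_map:
  assumes "x \<in> arcs (bigraph G)"
  shows "continuous_map (top_of_set {0..1}) (geometric_realization G) (arc_map G x)"
proof -
  have e: "fst x \<in> edges G"
    using assms by (auto simp: arcs_bigraph)
  have "continuous_map (top_of_set {0..1}) (top_of_set {0..1}) (\<lambda>q::real. if snd x then q else 1 - q)"
    by (cases "snd x") (auto intro!: continuous_intros)
  from continuous_map_compose[OF this continuous_char_map[OF e]] show ?thesis
    by (simp add: arc_map_def[abs_def] o_def)
qed

context rooted_graph
begin

abbreviation "R \<equiv> geometric_realization G"

lemma quotient_char_map:
  "quotient_map (prod_topology (discrete_topology (edges G)) (top_of_set {0..1})) R (\<lambda>(e, t). char_map G e t)"
proof -
  have V: "Vertex v \<in> (\<lambda>(e, t). char_map G e t) ` (edges G \<times> {0..1})" if "v \<in> V" for v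
  proof -
    obtain x where x: "x \<in> arcs (bigraph G)" "src G x = v"
    proof (cases "v = r")
      case True
      obtain w where "w \<in> children r"
        using live_child[OF live_root] by auto
      then show ?thesis
        using that[of "pa w"] True pa_arc src_pa by (auto simp: children_def)
    next
      case False
      then show ?thesis
        using that[of "rev_arc (pa v)"] \<open>v \<in> V\<close> pa_arc tgt_pa by simp
    qed
    have "(\<lambda>(e, t). char_map G e t) (fst x, if snd x then 0 else 1) = Vertex v"
      using x(2) arc_map_0[of G x] by (simp add: arc_map_def split: if_splits)
    moreover have "(fst x, if snd x then 0 else 1) \<in> edges G \<times> {0..1::real}"
      using x(1) by (auto simp: arcs_bigraph)
    ultimately show ?thesis
      by (metis imageI)
  qed
  have surj: "(\<lambda>(e, t). char_map G e t) ` (edges G \<times> {0..1}) = topspace R"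
    unfolding topspace_realization_char_map using V by force
  have "openin (prod_topology (discrete_topology (edges G)) (top_of_set {0..1}))
      {x \<in> edges G \<times> {0..1}. (\<lambda>(e, t). char_map G e t) x \<in> U} \<longleftrightarrow> openin R U"
    if "U \<subseteq> topspace R" for U
  proof -
    have "U \<subseteq> Vertex ` V \<union> (\<Union>e\<in>edges G. char_map G e ` {0..1})"
      using that unfolding topspace_realization_char_map .
    moreover have "{y. (e, y) \<in> {x \<in> edges G \<times> {0..1}. (\<lambda>(e, t). char_map G e t) x \<in> U}} =
        {t \<in> {0..1}. char_map G e t \<in> U}" if "e \<in> edges G" for e
      using that by auto
    ultimately show ?thesis
      unfolding openin_prod_discrete_topology openin_geometric_realization by auto
  qed
  then show ?thesis
    using surj by (simp add: quotient_map_def)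
qed

text \<open>The path from the root to \<open>v\<close> in the tree, parametrized by arc length on \<open>{0..n}\<close>, where
  \<open>n = dist v\<close>.\<close>

primrec vpath :: "nat \<Rightarrow> 'v \<Rightarrow> real \<Rightarrow> ('v, 'e) realization_point" where
  "vpath 0 v s = Vertex v"
| "vpath (Suc n) v s = (if s \<le> real n then vpath n (par v) s else arc_map G (pa v) (s - real n))"

text \<open>The tree path to the source of \<open>x\<close>, continued along \<open>x\<close>. For a
  parent arc this is again a tree path; for a chord it runs off the tree.\<close>

definition apath :: "'e \<times> bool \<Rightarrow> real \<Rightarrow> ('v, 'e) realization_point" where
  "apath x s = (if s \<le> real (dist (src G x)) then vpath (dist (src G x)) (src G x) s
    else arc_map G x (s - real (dist (src G x))))"

lemma vpath_eq_apath: "v \<in> V - {r} \<Longrightarrow> vpath (dist v) v = apath (pa v)"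
  using dist_par[of v] src_pa[of v] by (auto simp: apath_def fun_eq_iff)

lemma vpath_0: "v \<in> V \<Longrightarrow> vpath (dist v) v 0 = Vertex r"
proof (induction "dist v" arbitrary: v)
  case 0
  then show ?case using dist_eq_0 by fastforce
next
  case (Suc n)
  then have "v \<in> V - {r}" using root by auto
  then show ?case
    using Suc dist_par[of v] par_in_V[of v] by (auto simp flip: Suc(2))
qed

lemma vpath_dist: "v \<in> V \<Longrightarrow> vpath (dist v) v (real (dist v)) = Vertex v"
proof (cases "v = r")
  case False
  assume "v \<in> V"
  then have v: "v \<in> V - {r}" using False by simp
  then show ?thesis
    using dist_par[OF v] tgt_pa[OF v] by simp
qed (use root in auto)

text \<open>Continuity of \<open>vpath\<close> is a hypothesis because its own induction rests on
  this gluing; the two pieces agree at the source of \<open>x\<close>.\<close>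

lemma apath_continuous_aux:
  assumes "x \<in> arcs (bigraph G)"
    and "continuous_map (top_of_set {0..real (dist (src G x))}) R (vpath (dist (src G x)) (src G x))"
  shows "continuous_map (top_of_set {0..real (dist (src G x)) + 1}) R (apath x)"
proof -
  define d where "d = real (dist (src G x))"
  have sv: "src G x \<in> V"
    by (rule wf_mgraph_arc_ends(1)[OF wf assms(1)])
  have "continuous_map (top_of_set {0..d + 1}) R
      (\<lambda>s. if s \<le> d then vpath (dist (src G x)) (src G x) s else arc_map G x (s - d))"
  proof (rule continuous_map_cases_le)
    have "continuous_map (top_of_set {d..d + 1}) R (arc_map G x \<circ> (\<lambda>s. s - d))"
      by (rule continuous_map_compose[OF _ continuous_arc_map[OF assms(1)]]) (auto intro!: continuous_intros)
    then have "continuous_map (top_of_set {d..d + 1}) R (\<lambda>s. arc_map G x (s - d))"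
      by (simp add: o_def)
    then show "continuous_map (subtopology (top_of_set {0..d + 1}) {s \<in> topspace (top_of_set {0..d + 1}). d \<le> s}) R
        (\<lambda>s. arc_map G x (s - d))"
      unfolding subtopology_subtopology by (rule continuous_map_from_subtopology_mono) auto
    show "continuous_map (subtopology (top_of_set {0..d + 1}) {s \<in> topspace (top_of_set {0..d + 1}). s \<le> d}) R
        (vpath (dist (src G x)) (src G x))"
      unfolding subtopology_subtopology
      by (rule continuous_map_from_subtopology_mono[OF assms(2)]) (auto simp: d_def)
  qed (use vpath_dist[OF sv] in \<open>auto simp: d_def\<close>)
  then show ?thesis
    unfolding apath_def[abs_def] d_def .
qed

lemma continuous_vpath: "v \<in> V \<Longrightarrow> continuous_map (top_of_set {0..real (dist v)}) R (vpath (dist v) v)"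
proof (induction "dist v" arbitrary: v)
  case 0
  then show ?case
    by (auto simp flip: 0(1) simp: topspace_geometric_realization[OF wf])
next
  case (Suc n)
  then have v: "v \<in> V - {r}" using root by auto
  have "continuous_map (top_of_set {0..real (dist (par v))}) R (vpath (dist (par v)) (par v))"
    using Suc dist_par[OF v] par_in_V[OF v] by auto
  then have "continuous_map (top_of_set {0..real (dist (par v)) + 1}) R (apath (pa v))"
    using apath_continuous_aux[OF pa_arc[OF v]] by (simp add: src_pa[OF v])
  then show ?case
    using vpath_eq_apath[OF v] dist_par[OF v] by (simp add: add.commute)
qed

lemma continuous_apath:
  "x \<in> arcs (bigraph G) \<Longrightarrow> continuous_map (top_of_set {0..real (dist (src G x)) + 1}) R (apath x)"
  by (intro apath_continuous_aux continuous_vpath wf_mgraph_arc_ends(1)[OF wf])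

lemma apath_0: "x \<in> arcs (bigraph G) \<Longrightarrow> apath x 0 = Vertex r"
  by (simp add: apath_def vpath_0 wf_mgraph_arc_ends(1)[OF wf])

lemma apath_end:
  "x \<in> arcs (bigraph G) \<Longrightarrow> 0 \<le> q \<Longrightarrow> apath x (real (dist (src G x)) + q) = arc_map G x q"
  by (auto simp: apath_def vpath_dist wf_mgraph_arc_ends(1)[OF wf])

section \<open>Cutting the chords, and the contraction of what is left\<close>

definition tree_points :: "('v, 'e) realization_point set" where
  "tree_points = Vertex ` V \<union> {Inner e t |e t. e \<in> tree_edges \<and> 0 < t \<and> t < 1}"

lemma arc_map_tree_points:
  "v \<in> V - {r} \<Longrightarrow> 0 \<le> q \<Longrightarrow> q \<le> 1 \<Longrightarrow> arc_map G (pa v) q \<in> tree_points"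
proof -
  assume v: "v \<in> V - {r}" and q: "0 \<le> q" "q \<le> 1"
  consider "q = 0" | "q = 1" | "0 < q" "q < 1"
    using q by linarith
  then show ?thesis
    using v par_in_V[OF v] pa_tree[OF v] src_pa[OF v] tgt_pa[OF v]
    by cases (auto simp: tree_points_def arc_map_Inner)
qed

lemma vpath_tree_points: "v \<in> V \<Longrightarrow> 0 \<le> s \<Longrightarrow> s \<le> real (dist v) \<Longrightarrow> vpath (dist v) v s \<in> tree_points"
proof (induction "dist v" arbitrary: v)
  case 0
  then show ?case by (auto simp flip: 0(1) simp: tree_points_def)
next
  case (Suc n)
  then have v: "v \<in> V - {r}" using root by auto
  have "vpath (dist (par v)) (par v) s \<in> tree_points" if "s \<le> real (dist (par v))"
    using Suc(1)[of "par v"] Suc(2,4) dist_par[OF v] par_in_V[OF v] that by auto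
  then show ?case
    using arc_map_tree_points[OF v, of "s - real (dist (par v))"] Suc.prems dist_par[OF v] by auto
qed


text \<open>The tree with two whiskers for every chord, left after removing the middle segments \<open>{c..d}\<close>.\<close>

definition region :: "real \<Rightarrow> real \<Rightarrow> ('v, 'e) realization_point set" where
  "region c d = tree_points \<union> {Inner e t |e t. e \<in> chords \<and> 0 < t \<and> t < 1 \<and> (t < c \<or> d < t)}"

text \<open>The arcs along which points are pulled back: tree arcs only away from the root, chords
  in both directions because their two whiskers are pulled to different ends.\<close>

definition branches :: "('e \<times> bool) set" where
  "branches = pa ` (V - {r}) \<union> {x \<in> arcs (bigraph G). fst x \<in> chords}"

text \<open>The part of the arc inside the region. On a reversed chord the parameter is
  \<open>1 - t\<close>, so \<open>d < t\<close> becomes \<open>q < 1 - d\<close>.\<close>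

definition branch_dom :: "real \<Rightarrow> real \<Rightarrow> 'e \<times> bool \<Rightarrow> real set" where
  "branch_dom c d x = (if fst x \<in> chords then if snd x then {0..<c} else {0..<1 - d} else {0..1})"

text \<open>For a tree edge the choice is unique by \<open>fst_pa_inj\<close>. On a chord the test
  \<open>t < c\<close> tells the two whiskers apart, since a point of the region with
  \<open>\<not> t < c\<close> satisfies \<open>d < t\<close>.\<close>

definition branch_of :: "real \<Rightarrow> 'e \<Rightarrow> real \<Rightarrow> 'e \<times> bool" where
  "branch_of c e t = (if e \<in> chords then (e, t < c) else (SOME x. x \<in> pa ` (V - {r}) \<and> fst x = e))"

text \<open>At time \<open>s\<close> each point sits at the fraction \<open>s\<close> of the arc
  length of its path from the root.\<close>

definition contraction :: "real \<Rightarrow> real \<times> ('v, 'e) realization_point \<Rightarrow> ('v, 'e) realization_point" where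
  "contraction c = (\<lambda>(s, p). case p of
      Vertex v \<Rightarrow> vpath (dist v) v (s * real (dist v))
    | Inner e t \<Rightarrow> let x = branch_of c e t in
        apath x (s * (real (dist (src G x)) + (if snd x then t else 1 - t))))"

lemma tree_edges_Int_chords: "e \<in> tree_edges \<Longrightarrow> e \<notin> chords"
  by (simp add: chords_def)

lemma topspace_R: "topspace R = tree_points \<union> {Inner e t |e t. e \<in> chords \<and> 0 < t \<and> t < 1}"
  using tree_edges_subset unfolding topspace_geometric_realization[OF wf] tree_points_def chords_def by blast

lemma branches_arcs: "x \<in> branches \<Longrightarrow> x \<in> arcs (bigraph G)"
  using pa_arc by (auto simp: branches_def)

lemma branch_cases:
  assumes "x \<in> branches"
  obtains (tree) v where "v \<in> V - {r}" "x = pa v" "fst x \<notin> chords" | (chord) "x \<in> arcs (bigraph G)" "fst x \<in> chords"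
  using assms pa_tree tree_edges_Int_chords by (auto simp: branches_def)

context
  fixes c d :: real
  assumes cd: "0 < c" "c \<le> d" "d < 1"
begin

lemma branch_dom_bounds:
  assumes "q \<in> branch_dom c d x"
  shows "0 \<le> q" "q \<le> 1"
  using assms cd by (auto simp: branch_dom_def split: if_splits)

lemma branch_dom_down: "q \<in> branch_dom c d x \<Longrightarrow> 0 \<le> q' \<Longrightarrow> q' \<le> q \<Longrightarrow> q' \<in> branch_dom c d x"
  by (auto simp: branch_dom_def split: if_splits)

lemma branch_of_arc:
  assumes "x \<in> branches" "q \<in> branch_dom c d x"
  shows "branch_of c (fst x) (if snd x then q else 1 - q) = x"
  using assms(1)
proof (cases rule: branch_cases)
  case (tree v)
  have "(SOME y. y \<in> pa ` (V - {r}) \<and> fst y = fst x) = x"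
  proof (rule some_equality)
    show "x \<in> pa ` (V - {r}) \<and> fst x = fst x"
      using tree by auto
    show "y = x" if "y \<in> pa ` (V - {r}) \<and> fst y = fst x" for y
      using that tree fst_pa_inj[of _ v] by auto
  qed
  then show ?thesis
    using tree by (simp add: branch_of_def)
next
  case chord
  then show ?thesis
    using assms(2) cd by (cases x) (auto simp: branch_of_def branch_dom_def split: if_splits)
qed

text \<open>A vertex lies on several branches, so agreement at the ends is the point. At
  \<open>q = 0\<close> the path stays in the tree. The value \<open>q = 1\<close> occurs only for
  parent arcs, because chord domains stop before 1, and there \<open>vpath_eq_apath\<close>
  applies.\<close>

lemma contraction_arc_map:
  assumes x: "x \<in> branches" and q: "q \<in> branch_dom c d x" and s: "0 \<le> s" "s \<le> 1"
  shows "contraction c (s, arc_map G x q) = apath x (s * (real (dist (src G x)) + q))"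
proof -
  have q01: "0 \<le> q" "q \<le> 1"
    using branch_dom_bounds[OF q] .
  consider "q = 0" | "q = 1" | "0 < q" "q < 1"
    using q01 by linarith
  then show ?thesis
  proof cases
    case 1
    then show ?thesis
      using s by (simp add: contraction_def apath_def mult_left_le_one_le)
  next
    case 2
    show ?thesis
      using x
    proof (cases rule: branch_cases)
      case (tree v)
      have "arc_map G x q = Vertex v"
        using 2 tree tgt_pa[of v] by simp
      then have "contraction c (s, arc_map G x q) = apath x (s * real (dist v))"
        using vpath_eq_apath[OF tree(1)] tree(2) by (simp add: contraction_def)
      moreover have "real (dist v) = real (dist (src G x)) + q"
        using dist_par[OF tree(1)] src_pa[OF tree(1)] tree(2) 2 by simp
      ultimately show ?thesis
        by simp
    next
      case chord
      then show ?thesis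
        using 2 q cd by (auto simp: branch_dom_def split: if_splits)
    qed
  next
    case 3
    then show ?thesis
      by (simp add: contraction_def arc_map_Inner branch_of_arc[OF x q] Let_def)
  qed
qed

lemma arc_map_in_region:
  assumes x: "x \<in> branches" and q: "q \<in> branch_dom c d x"
  shows "arc_map G x q \<in> region c d"
  using x
proof (cases rule: branch_cases)
  case (tree v)
  then show ?thesis
    using arc_map_tree_points[of v q] branch_dom_bounds[OF q] by (auto simp: region_def)
next
  case chord
  consider "q = 0" | "0 < q" "q < 1"
    using q chord cd by (fastforce simp: branch_dom_def split: if_splits)
  then show ?thesis
  proof cases
    case 1
    then show ?thesis
      using wf_mgraph_arc_ends(1)[OF wf chord(1)] by (simp add: region_def tree_points_def)
  next
    case 2
    then show ?thesis
      using q chord(2) cd by (auto simp: region_def arc_map_Inner branch_dom_def split: if_splits)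
  qed
qed

lemma region_branch:
  assumes "p \<in> region c d"
  obtains x q where "x \<in> branches" "q \<in> branch_dom c d x" "p = arc_map G x q"
proof -
  consider v where "v \<in> V" "p = Vertex v" | e t where "e \<in> tree_edges" "0 < t" "t < 1" "p = Inner e t"
    | e t where "e \<in> chords" "0 < t" "t < 1" "t < c \<or> d < t" "p = Inner e t"
    using assms by (auto simp: region_def tree_points_def)
  then show thesis
  proof cases
    case (1 v)
    show thesis
    proof (cases "v = r")
      case True
      obtain w where "w \<in> children r"
        using live_child[OF live_root] by auto
      then have w: "w \<in> V - {r}" "par w = r"
        by (auto simp: children_def)
      then have "0 \<in> branch_dom c d (pa w)"
        using pa_tree tree_edges_Int_chords by (simp add: branch_dom_def)
      then show ?thesis
        using that[of "pa w" 0] w 1 True src_pa[OF w(1)] by (auto simp: branches_def)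
    next
      case False
      then have v: "v \<in> V - {r}" using 1 by simp
      then have "1 \<in> branch_dom c d (pa v)"
        using pa_tree tree_edges_Int_chords by (simp add: branch_dom_def)
      then show ?thesis
        using that[of "pa v" 1] v 1 tgt_pa[OF v] by (auto simp: branches_def)
    qed
  next
    case (2 e t)
    then obtain v where v: "v \<in> V - {r}" "e = fst (pa v)"
      by (auto simp: tree_edges_def)
    define q where "q = (if snd (pa v) then t else 1 - t)"
    have "q \<in> branch_dom c d (pa v)" "p = arc_map G (pa v) q"
      using 2 v tree_edges_Int_chords by (auto simp: q_def branch_dom_def arc_map_Inner)
    moreover have "pa v \<in> branches"
      using v by (simp add: branches_def)
    ultimately show thesis
      using that by blast
  next
    case (3 e t)
    define b where "b \<longleftrightarrow> t < c"
    define q where "q = (if b then t else 1 - t)"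
    have "q \<in> branch_dom c d (e, b)" "p = arc_map G (e, b) q"
      using 3 by (auto simp: q_def b_def branch_dom_def arc_map_Inner)
    moreover have "(e, b) \<in> branches"
      using 3 by (auto simp: branches_def arcs_bigraph chords_def)
    ultimately show thesis
      using that by blast
  qed
qed

lemma apath_in_region:
  assumes x: "x \<in> branches" and q: "q \<in> branch_dom c d x" and u: "0 \<le> u" "u \<le> real (dist (src G x)) + q"
  shows "apath x u \<in> region c d"
proof (cases "u \<le> real (dist (src G x))")
  case True
  then show ?thesis
    using vpath_tree_points[of "src G x" u] u wf_mgraph_arc_ends(1)[OF wf branches_arcs[OF x]]
    by (simp add: apath_def region_def)
next
  case False
  then have "u - real (dist (src G x)) \<in> branch_dom c d x"
    using branch_dom_down[OF q] u by simp
  then show ?thesis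
    using arc_map_in_region[OF x] False by (simp add: apath_def)
qed

lemma region_subset: "region c d \<subseteq> topspace R"
  unfolding topspace_R by (auto simp: region_def)

lemma char_map_region:
  assumes e: "e \<in> edges G" and t: "t \<in> {0..1}"
  shows "char_map G e t \<in> region c d \<longleftrightarrow> (e \<in> chords \<longrightarrow> t < c \<or> d < t)"
proof -
  have ends: "Vertex (fst (orient G e)) \<in> region c d" "Vertex (snd (orient G e)) \<in> region c d"
    using wf_mgraph_arc_ends[OF wf, of "(e, True)"] e
    by (auto simp: arcs_bigraph src_eq tgt_eq region_def tree_points_def)
  show ?thesis
  proof (cases "e \<in> chords")
    case True
    then show ?thesis
      using ends t cd tree_edges_Int_chords[of e] by (auto simp: char_map_def region_def tree_points_def)
  next
    case False
    then have "e \<in> tree_edges"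
      using e by (simp add: chords_def)
    then show ?thesis
      using False ends t by (auto simp: char_map_def region_def tree_points_def)
  qed
qed

lemma openin_region: "openin R (region c d)"
proof -
  have "openin (top_of_set {0..1}) {t \<in> {0..1}. char_map G e t \<in> region c d}" if e: "e \<in> edges G" for e
  proof -
    have "{t \<in> {0..1}. char_map G e t \<in> region c d} =
        (if e \<in> chords then {0..1} \<inter> ({..<c} \<union> {d<..}) else {0..1})"
      using char_map_region[OF e] by auto
    moreover have "openin (top_of_set {0..1}) ({0..1} \<inter> ({..<c} \<union> {d<..}))"
      by (rule openin_open_Int) auto
    ultimately show ?thesis
      by auto
  qed
  then show ?thesis
    using region_subset[unfolded topspace_realization_char_map] by (simp add: openin_geometric_realization)
qed

lemma contraction_endpoints:
  assumes "p \<in> region c d"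
  shows "contraction c (0, p) = Vertex r" "contraction c (1, p) = p"
proof -
  obtain x q where xq: "x \<in> branches" "q \<in> branch_dom c d x" "p = arc_map G x q"
    using region_branch[OF assms] .
  have "0 \<le> q"
    using branch_dom_bounds(1)[OF xq(2)] .
  then show "contraction c (0, p) = Vertex r" "contraction c (1, p) = p"
    using contraction_arc_map[OF xq(1,2), of 0] contraction_arc_map[OF xq(1,2), of 1] xq(3)
      apath_0[OF branches_arcs[OF xq(1)]] apath_end[OF branches_arcs[OF xq(1)]] by simp_all
qed

lemma contraction_in_region:
  assumes "p \<in> region c d" "0 \<le> s" "s \<le> 1"
  shows "contraction c (s, p) \<in> region c d"
proof -
  obtain x q where xq: "x \<in> branches" "q \<in> branch_dom c d x" "p = arc_map G x q"
    using region_branch[OF assms(1)] .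
  have "0 \<le> q"
    using branch_dom_bounds(1)[OF xq(2)] .
  then have "0 \<le> s * (real (dist (src G x)) + q)" "s * (real (dist (src G x)) + q) \<le> real (dist (src G x)) + q"
    using assms(2,3) by (auto intro: mult_left_le_one_le)
  then have "apath x (s * (real (dist (src G x)) + q)) \<in> region c d"
    by (rule apath_in_region[OF xq(1,2)])
  then show ?thesis
    unfolding xq(3) contraction_arc_map[OF xq(1,2) assms(2,3)] .
qed

text \<open>The unit interval is locally compact Hausdorff, so its product with the quotient map
  from edges and parameters is again a quotient map. Continuity can thus be tested upstairs, where
  each branch owns an open sheet and the map is \<open>apath\<close> after a rescaling.\<close>

lemma continuous_contraction:
  "continuous_map (prod_topology (top_of_set {0..1}) (subtopology R (region c d))) (subtopology R (region c d)) (contraction c)"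
proof -
  let ?I = "top_of_set {0..1::real}"
  let ?f = "\<lambda>(e, t). char_map G e t"
  define Z where "Z = prod_topology (discrete_topology (edges G)) ?I"
  define W where "W = {z \<in> topspace Z. ?f z \<in> region c d}"
  define P where "P = prod_topology ?I (subtopology Z W)"
  have "quotient_map (subtopology Z W) (subtopology R (region c d)) ?f"
    using quotient_map_restriction[OF quotient_char_map] openin_region unfolding Z_def W_def by blast
  moreover have "locally_compact_space ?I" "Hausdorff_space ?I"
    by (auto intro!: compact_imp_locally_compact_space compact_space_subtopology Hausdorff_space_subtopology)
  ultimately have quo: "quotient_map P (prod_topology ?I (subtopology R (region c d))) (\<lambda>(s, z). (s, ?f z))"
    unfolding P_def using quotient_map_prod_right by blast
  define T where "T x = {(s::real, e, t). s \<in> {0..1} \<and> e = fst x \<and> (if snd x then t else 1 - t) \<in> branch_dom c d x}" for x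
  have topP: "topspace P = {0..1} \<times> W"
    by (auto simp: P_def W_def)
  have "continuous_map P R (contraction c \<circ> (\<lambda>(s, z). (s, ?f z)))"
  \<comment> \<open>All pasted functions are the same; the lemma serves to localize continuity to
    the open sheets \<open>T x\<close>.\<close>
  proof (rule pasting_lemma[where I = branches and T = "\<lambda>x. T x \<inter> topspace P"
        and f = "\<lambda>_. contraction c \<circ> (\<lambda>(s, z). (s, ?f z))"])
    fix x assume x: "x \<in> branches"
    define N where "N = {t. t \<in> {0..1} \<and> (if snd x then t else 1 - t) \<in> branch_dom c d x}"
    have e: "fst x \<in> edges G"
      using branches_arcs[OF x] by (auto simp: arcs_bigraph)
    have N: "openin ?I N"
    proof -
      have "N = (if fst x \<in> chords then if snd x then {0..1} \<inter> {..<c} else {0..1} \<inter> {d<..} else {0..1})"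
        using cd by (auto simp: N_def branch_dom_def split: if_splits)
      then show ?thesis
        by (auto simp: openin_open_Int)
    qed
    have "{y. (i, y) \<in> {fst x} \<times> N} = (if i = fst x then N else {})" for i
      by auto
    then have "openin Z ({fst x} \<times> N)"
      using e N openin_subset[OF N] unfolding Z_def openin_prod_discrete_topology by auto
    then have "openin P ({0..1} \<times> (W \<inter> {fst x} \<times> N))"
      unfolding P_def by (auto simp: openin_prod_Times_iff openin_subtopology_Int2)
    also have "{0..1} \<times> (W \<inter> {fst x} \<times> N) = T x \<inter> topspace P"
      unfolding topP by (auto simp: T_def N_def W_def Z_def)
    finally show "openin P (T x \<inter> topspace P)" .
    define D where "D = real (dist (src G x))"
    define h :: "real \<times> 'e \<times> real \<Rightarrow> real" where
      "h z = fst z * (D + (if snd x then snd (snd z) else 1 - snd (snd z)))" for z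
    let ?PT = "subtopology P (T x \<inter> topspace P)"
    have "continuous_map ?PT euclideanreal fst"
      unfolding P_def by (intro continuous_map_from_subtopology continuous_map_into_fulltopology[OF continuous_map_fst])
    moreover have "continuous_map ?PT euclideanreal (\<lambda>z. snd (snd z))"
    proof -
      have "continuous_map P Z snd"
        unfolding P_def by (rule continuous_map_into_fulltopology[OF continuous_map_snd])
      moreover have "continuous_map Z euclideanreal snd"
        unfolding Z_def by (rule continuous_map_into_fulltopology[OF continuous_map_snd])
      ultimately have "continuous_map P euclideanreal (snd \<circ> snd)"
        by (rule continuous_map_compose)
      then show ?thesis
        by (simp add: o_def continuous_map_from_subtopology)
    qed
    ultimately have "continuous_map ?PT euclideanreal (\<lambda>z. fst z * (D + (if snd x then snd (snd z) else 1 - snd (snd z))))"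
      by (cases "snd x") (auto intro!: continuous_intros)
    then have "continuous_map ?PT euclideanreal h"
      by (simp add: h_def[abs_def])
    moreover have "h z \<in> {0..D + 1}" if zT: "z \<in> T x" for z
    proof -
      obtain s e t where z: "z = (s, e, t)" "s \<in> {0..1}" "(if snd x then t else 1 - t) \<in> branch_dom c d x"
        using zT by (auto simp: T_def)
      have "D \<ge> 0"
        by (simp add: D_def)
      have hz: "h z = s * (D + (if snd x then t else 1 - t))"
        by (simp add: h_def z(1))
      have "h z \<le> 1 * (D + 1)"
        unfolding hz using z(2) branch_dom_bounds[OF z(3)] \<open>D \<ge> 0\<close> by (intro mult_mono) auto
      moreover have "0 \<le> h z"
        unfolding hz using z(2) branch_dom_bounds(1)[OF z(3)] \<open>D \<ge> 0\<close> by (intro mult_nonneg_nonneg add_nonneg_nonneg) auto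
      ultimately show ?thesis
        by simp
    qed
    ultimately have "continuous_map ?PT (top_of_set {0..D + 1}) h"
      by (auto simp: continuous_map_in_subtopology)
    then have "continuous_map ?PT R (apath x \<circ> h)"
      using continuous_apath[OF branches_arcs[OF x]] unfolding D_def by (rule continuous_map_compose)
    moreover have "(apath x \<circ> h) z = (contraction c \<circ> (\<lambda>(s, z). (s, ?f z))) z" if zT: "z \<in> T x" for z
    proof -
      obtain s e t where z: "z = (s, e, t)" "s \<in> {0..1}" "e = fst x" "(if snd x then t else 1 - t) \<in> branch_dom c d x"
        using zT by (auto simp: T_def)
      have "?f (e, t) = arc_map G x (if snd x then t else 1 - t)"
        using z(3) by (simp add: arc_map_def)
      then show ?thesis
        using contraction_arc_map[OF x z(4), of s] z(1,2) by (simp add: h_def D_def)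
    qed
    ultimately show "continuous_map ?PT R (contraction c \<circ> (\<lambda>(s, z). (s, ?f z)))"
      by (rule continuous_map_eq) auto
  next
    fix z assume zP: "z \<in> topspace P"
    then obtain s e t where z: "z = (s, e, t)" "s \<in> {0..1}" "e \<in> edges G" "t \<in> {0..1}" "char_map G e t \<in> region c d"
      by (auto simp: topP W_def Z_def)
    show "\<exists>x. x \<in> branches \<and> z \<in> T x \<inter> topspace P \<and>
        (contraction c \<circ> (\<lambda>(s, z). (s, ?f z))) z = (contraction c \<circ> (\<lambda>(s, z). (s, ?f z))) z"
    proof (cases "e \<in> chords")
      case True
      then have "t < c \<or> d < t"
        using z char_map_region by blast
      then have "(e, t < c) \<in> branches" "z \<in> T (e, t < c)"
        using z(1-4) True by (auto simp: branches_def arcs_bigraph T_def branch_dom_def)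
      then show ?thesis
        using zP by blast
    next
      case False
      then obtain v where "v \<in> V - {r}" "e = fst (pa v)"
        using z(3) by (auto simp: chords_def tree_edges_def)
      then have "pa v \<in> branches" "z \<in> T (pa v)"
        using z False by (auto simp: branches_def T_def branch_dom_def)
      then show ?thesis
        using zP by blast
    qed
  qed auto
  then have "continuous_map (prod_topology ?I (subtopology R (region c d))) R (contraction c)"
    using continuous_compose_quotient_map_eq[OF quo] by blast
  then show ?thesis
    using contraction_in_region by (auto simp: continuous_map_in_subtopology)
qed

lemma contractible_region: "contractible_space (subtopology R (region c d))"
proof -
  have "homotopic_with (\<lambda>_. True) (subtopology R (region c d)) (subtopology R (region c d)) (\<lambda>_. Vertex r) id"
  proof (subst homotopic_with)
    show "\<exists>h. continuous_map (prod_topology (top_of_set {0..1::real}) (subtopology R (region c d))) (subtopology R (region c d)) h \<and>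
        (\<forall>x\<in>topspace (subtopology R (region c d)). h (0, x) = Vertex r) \<and>
        (\<forall>x\<in>topspace (subtopology R (region c d)). h (1, x) = id x) \<and> (\<forall>t\<in>{0..1}. True)"
    proof (intro exI conjI ballI)
      show "continuous_map (prod_topology (top_of_set {0..1}) (subtopology R (region c d))) (subtopology R (region c d)) (contraction c)"
        by (rule continuous_contraction)
    qed (use contraction_endpoints in auto)
  qed simp
  then show ?thesis
    unfolding contractible_space_def by (intro exI[of _ "Vertex r"]) (rule homotopic_with_symD)
qed

end
end

section \<open>First homology of the realization\<close>

text \<open>The complement of a piece is a union of open pieces, so each piece is clopen and a
  connected set meeting it stays inside.\<close>

lemma path_components_of_open_partition:
  assumes "\<Union>\<U> = topspace X" "pairwise disjnt \<U>"
    and U: "\<And>U. U \<in> \<U> \<Longrightarrow> openin X U \<and> path_connectedin X U \<and> U \<noteq> {}"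
  shows "path_components_of X = \<U>"
proof -
  have component: "C = U" if "C \<in> path_components_of X" "U \<in> \<U>" "\<not> disjnt C U" for C U
  proof
    show "U \<subseteq> C"
      using U[OF that(2)] by (intro path_components_of_maximal[OF that(1) _ that(3)]) simp
    have "openin X (\<Union>(\<U> - {U}))"
      by (intro openin_Union) (simp add: U)
    moreover have "V \<inter> U = {}" if "V \<in> \<U> - {U}" for V
      using assms(2) that \<open>U \<in> \<U>\<close> by (auto simp: pairwise_def disjnt_def)
    then have "topspace X - U = \<Union>(\<U> - {U})"
      unfolding assms(1)[symmetric] by blast
    ultimately have "closedin X U"
      using U[OF that(2)] openin_subset[of X U] by (simp add: closedin_def)
    moreover have "connectedin X C"
      by (rule path_connectedin_imp_connectedin[OF path_connectedin_path_components_of[OF that(1)]])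
    ultimately show "C \<subseteq> U"
      using connectedin_clopen_cases[of X C U] U[OF that(2)] that(3) by simp
  qed
  show ?thesis
  proof (intro equalityI subsetI)
    fix C assume C: "C \<in> path_components_of X"
    then obtain x where "x \<in> C"
      using nonempty_path_components_of[OF C] by auto
    then obtain U where "U \<in> \<U>" "x \<in> U"
      using path_components_of_subset[OF C] assms(1) by auto
    then show "C \<in> \<U>"
      using component[OF C] \<open>x \<in> C\<close> by (auto simp: disjnt_def)
  next
    fix U assume "U \<in> \<U>"
    then obtain x where "x \<in> U"
      using U by auto
    then have "x \<in> \<Union>(path_components_of X)"
      using \<open>U \<in> \<U>\<close> assms(1) by (auto simp: Union_path_components_of)
    then obtain C where "C \<in> path_components_of X" "x \<in> C"
      by auto
    then show "U \<in> path_components_of X"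
      using component[of C U] \<open>U \<in> \<U>\<close> \<open>x \<in> U\<close> by (auto simp: disjnt_def)
  qed
qed

context rooted_graph
begin

text \<open>The two regions of the cover omit the points 1/4 and 3/4 of every chord; this is the
  segment between them.\<close>

definition middle :: "'e \<Rightarrow> ('v, 'e) realization_point set" where
  "middle e = Inner e ` {1/4<..<3/4}"

lemma region_Int:
  "region (1/4) (1/4) \<inter> region (3/4) (3/4) = region (1/4) (3/4) \<union> (\<Union>e\<in>chords. middle e)"
  using tree_edges_Int_chords by (fastforce simp: region_def tree_points_def middle_def)

lemma openin_middle:
  assumes "e \<in> chords"
  shows "openin R (middle e)"
proof -
  have "openin (top_of_set {0..1}) {t \<in> {0..1}. char_map G e' t \<in> middle e}" for e'
  proof -
    have "{t \<in> {0..1}. char_map G e' t \<in> middle e} = (if e' = e then {0..1} \<inter> {1/4<..<3/4} else {})"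
      by (auto simp: char_map_def middle_def)
    then show ?thesis
      by (auto simp: openin_open_Int)
  qed
  moreover have "middle e \<subseteq> topspace R"
    using assms unfolding topspace_R by (auto simp: middle_def)
  ultimately show ?thesis
    unfolding openin_geometric_realization topspace_realization_char_map by blast
qed

lemma path_connected_middle:
  assumes "e \<in> chords"
  shows "path_connectedin R (middle e)"
proof -
  have "path_connectedin (top_of_set {0..1::real}) {1/4<..<3/4}"
    by (subst path_connectedin_subtopology) (auto simp: path_connectedin_iff_path_connected_real is_interval_path_connected_1)
  moreover have "continuous_map (top_of_set {0..1}) R (char_map G e)"
    using assms by (intro continuous_char_map) (simp add: chords_def)
  ultimately have "path_connectedin R (char_map G e ` {1/4<..<3/4})"
    by (metis path_connectedin_continuous_map_image)
  moreover have "char_map G e ` {1/4<..<3/4} = middle e"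
    unfolding middle_def by (rule image_cong) (auto simp: char_map_def)
  ultimately show ?thesis
    by simp
qed

lemma root_in_region: "Vertex r \<in> region c d"
  using root by (simp add: region_def tree_points_def)

lemma path_components_Int:
  "path_components_of (subtopology R (region (1/4) (1/4) \<inter> region (3/4) (3/4))) \<approx> (UNIV :: unit set) <+> chords"
proof -
  let ?Y = "region (1/4) (1/4) \<inter> region (3/4) (3/4)"
  let ?U = "insert (region (1/4) (3/4)) (middle ` chords)"
  have sub: "middle e \<subseteq> ?Y" if "e \<in> chords" for e
    using that unfolding region_Int by blast
  have sub': "region (1/4) (3/4) \<subseteq> ?Y"
    unfolding region_Int by blast
  have Y: "?Y \<subseteq> topspace R"
    using region_subset[of "1/4" "1/4"] by auto
  have disj: "middle e \<inter> middle e' = {}" if "e \<noteq> e'" for e e'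
    using that by (auto simp: middle_def)
  have disj': "region (1/4) (3/4) \<inter> middle e = {}" if "e \<in> chords" for e
    using that tree_edges_Int_chords[of e] by (auto simp: middle_def region_def tree_points_def)
  have ne: "middle e \<noteq> {}" for e
    by (simp add: middle_def)
  have ne': "region (1/4) (3/4) \<noteq> {}"
    using root_in_region by blast
  have "path_components_of (subtopology R ?Y) = ?U"
  proof (rule path_components_of_open_partition)
    show "\<Union>?U = topspace (subtopology R ?Y)"
    proof -
      have "\<Union>?U = ?Y"
        by (simp add: region_Int)
      then show ?thesis
        unfolding topspace_subtopology using Y by (simp only: inf.absorb2)
    qed
    show "pairwise disjnt ?U"
      unfolding pairwise_insert pairwise_image
    proof (intro conjI)
      show "\<forall>y. y \<in> middle ` chords \<and> y \<noteq> region (1/4) (3/4) \<longrightarrow>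
          disjnt (region (1/4) (3/4)) y \<and> disjnt y (region (1/4) (3/4))"
        using disj' by (auto simp: disjnt_def Int_commute)
      show "pairwise (\<lambda>x y. middle x \<noteq> middle y \<longrightarrow> disjnt (middle x) (middle y)) chords"
        using disj by (auto simp: pairwise_def disjnt_def)
    qed
    have "path_connectedin R (region (1/4) (3/4))"
      using contractible_imp_path_connected_space[OF contractible_region[of "1/4" "3/4"]]
        region_subset[of "1/4" "3/4"] by (simp add: path_connectedin_def)
    moreover have "openin R (region (1/4) (3/4))"
      by (rule openin_region) auto
    ultimately have U: "openin R U \<and> path_connectedin R U \<and> U \<noteq> {} \<and> U \<subseteq> ?Y" if "U \<in> ?U" for U
      using that sub sub' ne ne' openin_middle path_connected_middle by auto
    show "openin (subtopology R ?Y) U \<and> path_connectedin (subtopology R ?Y) U \<and> U \<noteq> {}" if "U \<in> ?U" for U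
      using U[OF that] openin_subtopology_Int2[of R U ?Y] by (simp add: path_connectedin_subtopology Int_absorb1)
  qed
  moreover have "bij_betw (case_sum (\<lambda>_. region (1/4) (3/4)) middle) ((UNIV :: unit set) <+> chords) ?U"
  proof (rule bij_betw_imageI)
    show "inj_on (case_sum (\<lambda>_. region (1/4) (3/4)) middle) ((UNIV :: unit set) <+> chords)"
    proof (rule inj_onI)
      fix x y :: "unit + 'e"
      assume xy: "x \<in> UNIV <+> chords" "y \<in> UNIV <+> chords"
        "case_sum (\<lambda>_. region (1/4) (3/4)) middle x = case_sum (\<lambda>_. region (1/4) (3/4)) middle y"
      have neq: "region (1/4) (3/4) \<noteq> middle e" if "e \<in> chords" for e
        using disj'[OF that] ne[of e] by auto
      have inj: "e = e'" if "middle e = middle e'" for e e'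
        using disj[of e e'] ne[of e] that by auto
      show "x = y"
      proof (cases x)
        case (Inl a)
        then show ?thesis
          using xy neq by (cases y) auto
      next
        case (Inr e)
        then show ?thesis
          using xy neq[of e] inj by (cases y) auto
      qed
    qed
    show "case_sum (\<lambda>_. region (1/4) (3/4)) middle ` ((UNIV :: unit set) <+> chords) = ?U"
      by (auto simp: Plus_def image_Un image_image)
  qed
  ultimately have "(UNIV :: unit set) <+> chords \<approx> path_components_of (subtopology R ?Y)"
    unfolding eqpoll_def by auto
  then show ?thesis
    by (rule eqpoll_sym)
qed

text \<open>Contractibility of \<open>?A\<close> turns H_1 of \<open>R\<close> into H_1 of the pair
  with \<open>?A\<close>, excision replaces that pair by \<open>?C\<close> and the intersection, and
  contractibility of \<open>?C\<close> identifies Z plus this relative group with H_0 of the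
  intersection.\<close>

lemma homology_1_realization:
  "integer_group \<times>\<times> homology_group 1 R \<cong> free_Abelian_group ((UNIV :: unit set) <+> chords)"
proof -
  let ?A = "region (1/4) (1/4)" and ?C = "region (3/4) (3/4)"
  \<comment> \<open>The excised set consists of the points missing from \<open>?C\<close>. It is
    closed and lies in the open set \<open>?A\<close>, as excision requires.\<close>
  define U :: "('v, 'e) realization_point set" where "U = {Inner e (3/4) |e. e \<in> chords}"
  have UC: "topspace R - U = ?C"
    unfolding topspace_R U_def region_def tree_points_def using tree_edges_Int_chords by fastforce
  have UA: "U \<subseteq> ?A"
  proof
    fix p assume "p \<in> U"
    then obtain e where "p = Inner e (3/4)" "e \<in> chords"
      by (auto simp: U_def)
    then have "p \<in> {Inner e t |e t. e \<in> chords \<and> 0 < t \<and> t < 1 \<and> (t < 1/4 \<or> 1/4 < t)}"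
      by (intro CollectI exI[of _ e] exI[of _ "3/4"]) auto
    then show "p \<in> ?A"
      by (simp add: region_def)
  qed
  have opA: "openin R ?A" and opC: "openin R ?C"
    by (simp_all add: openin_region)
  have AR: "?A \<subseteq> topspace R" and CR: "?C \<subseteq> topspace R"
    using opA opC openin_subset by auto
  have clU: "closedin R U"
    using opC UC UA AR unfolding closedin_def by auto
  have AC: "?A - U = ?A \<inter> ?C"
    using UC AR by blast
  have "hom_induced 1 (subtopology R (topspace R - U)) (?A - U) (subtopology R (topspace R)) ?A id
    \<in> iso (relative_homology_group 1 (subtopology R (topspace R - U)) (?A - U))
          (relative_homology_group 1 (subtopology R (topspace R)) ?A)"
    by (rule homology_excision_axiom) (use clU UA opA AR in \<open>simp_all add: closure_of_closedin interior_of_openin\<close>)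
  then have exc: "relative_homology_group 1 (subtopology R ?C) (?A \<inter> ?C) \<cong> relative_homology_group 1 R ?A"
    unfolding UC AC by (simp add: is_isoI)
  have "hom_induced 1 R {} R ?A id \<in> iso (reduced_homology_group 1 R) (relative_homology_group 1 R ?A)"
    using contractible_region[of "1/4" "1/4"] root_in_region AR
    by (intro iso_reduced_homology_by_contractible) auto
  then have "homology_group 1 R \<cong> relative_homology_group 1 R ?A"
    by (simp add: un_reduced_homology_group is_isoI)
  also have "\<dots> \<cong> relative_homology_group 1 (subtopology R ?C) (?A \<inter> ?C)"
    by (rule group.iso_sym[OF _ exc]) simp
  finally have H1: "homology_group 1 R \<cong> relative_homology_group 1 (subtopology R ?C) (?A \<inter> ?C)" .
  have "homology_group 0 (subtopology (subtopology R ?C) (?A \<inter> ?C)) \<cong>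
      integer_group \<times>\<times> relative_homology_group 1 (subtopology R ?C) (?A \<inter> ?C)"
    using root_in_region[of "1/4" "1/4"] root_in_region[of "3/4" "3/4"] CR contractible_region[of "3/4" "3/4"]
    by (intro iso_homology_contractible_space_subtopology1) auto
  moreover have "subtopology (subtopology R ?C) (?A \<inter> ?C) = subtopology R (?A \<inter> ?C)"
    by (simp add: subtopology_subtopology inf.absorb2)
  ultimately have H0: "homology_group 0 (subtopology R (?A \<inter> ?C)) \<cong>
      integer_group \<times>\<times> relative_homology_group 1 (subtopology R ?C) (?A \<inter> ?C)"
    by simp
  have "integer_group \<times>\<times> homology_group 1 R \<cong>
      integer_group \<times>\<times> relative_homology_group 1 (subtopology R ?C) (?A \<inter> ?C)"
    using H1 by (intro group.DirProd_iso_trans) auto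
  also have "\<dots> \<cong> homology_group 0 (subtopology R (?A \<inter> ?C))"
    by (rule group.iso_sym[OF _ H0]) simp
  also have "\<dots> \<cong> free_Abelian_group (path_components_of (subtopology R (?A \<inter> ?C)))"
    by (rule zeroth_homology_group)
  also have "\<dots> \<cong> free_Abelian_group ((UNIV :: unit set) <+> chords)"
    using path_components_Int by (simp add: isomorphic_free_Abelian_groups)
  finally show ?thesis .
qed

end

section \<open>Components and direct limits\<close>

lemma in_component_of_self: "v \<in> vertices H \<Longrightarrow> v \<in> vertices (component_of H v)"
  by (simp add: component_of_def Let_def)

lemma vertices_component_of: "vertices (component_of H v) = {w \<in> vertices H. (v, w) \<in> (adjacency H)\<^sup>*}"
  by (simp add: component_of_def Let_def)

lemma edges_component_of:
  "edges (component_of H v) = {e \<in> edges H. set_uprod (ends H e) \<subseteq> vertices (component_of H v)}"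
  by (simp add: component_of_def Let_def)

lemma sym_adjacency_rtrancl: "(u, v) \<in> (adjacency H)\<^sup>* \<Longrightarrow> (v, u) \<in> (adjacency H)\<^sup>*"
  using sym_rtrancl[OF sym_adjacency] by (rule symD)

lemma component_of_eq:
  assumes "w \<in> vertices (component_of H v)"
  shows "component_of H w = component_of H v"
proof -
  have vw: "(v, w) \<in> (adjacency H)\<^sup>*"
    using assms by (simp add: vertices_component_of)
  have "(w, u) \<in> (adjacency H)\<^sup>* \<longleftrightarrow> (v, u) \<in> (adjacency H)\<^sup>*" for u
    using vw sym_adjacency_rtrancl[OF vw] by (meson rtrancl_trans)
  then show ?thesis
    by (simp add: component_of_def)
qed

lemma component_eq_component_of:
  assumes "Y \<in> components_mgraph H" "v \<in> vertices Y"
  shows "Y = component_of H v"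
proof -
  obtain y where "Y = component_of H y"
    using assms(1) by (auto simp: components_mgraph_def)
  then show ?thesis
    using component_of_eq[of v H y] assms(2) by simp
qed

lemma arcs_remove_subgraph: "arcs (bigraph (remove_subgraph G X)) = {x \<in> arcs (bigraph G). fst x \<notin> edges X}"
  by (auto simp: remove_subgraph_def arcs_bigraph)

text \<open>Orientations are chosen from \<open>ends\<close> alone, so deleting edges preserves the
  sources and targets of the remaining arcs.\<close>

lemma orient_remove_subgraph: "orient (remove_subgraph G X) = orient G"
  by (simp add: remove_subgraph_def orient_def fun_eq_iff)

lemma src_remove_subgraph: "src (remove_subgraph G X) x = src G x"
  and tgt_remove_subgraph: "tgt (remove_subgraph G X) x = tgt G x"
  by (cases x; simp add: src_eq tgt_eq orient_remove_subgraph)+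

lemma adjacency_remove_subgraph:
  "adjacency (remove_subgraph G X) = {(src G x, tgt G x) |x. x \<in> arcs (bigraph G) \<and> fst x \<notin> edges X}"
  by (auto simp: adjacency_eq_arcs arcs_remove_subgraph src_remove_subgraph tgt_remove_subgraph)

lemma vertices_remove_subgraph_arc:
  assumes "x \<in> arcs (bigraph G)" "fst x \<notin> edges X"
  shows "src G x \<in> vertices (remove_subgraph G X)" "tgt G x \<in> vertices (remove_subgraph G X)"
proof -
  have "fst x \<in> edges G - edges X"
    using assms by (auto simp: arcs_bigraph)
  then have "set_uprod (ends G (fst x)) \<subseteq> vertices (remove_subgraph G X)"
    by (auto simp: remove_subgraph_def)
  then show "src G x \<in> vertices (remove_subgraph G X)" "tgt G x \<in> vertices (remove_subgraph G X)"
    by (simp_all add: set_ends_arc)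
qed

lemma vertices_remove_subgraph_subset: "wf_mgraph G \<Longrightarrow> vertices (remove_subgraph G X) \<subseteq> vertices G"
  by (auto simp: remove_subgraph_def wf_mgraph_def)

lemma countably_infinite_eqpoll:
  assumes "countable A" "infinite A" "countable B" "infinite B"
  shows "A \<approx> B"
proof -
  have "A \<approx> (UNIV :: nat set)" "B \<approx> (UNIV :: nat set)"
    using to_nat_on_infinite assms unfolding eqpoll_def by blast+
  then show ?thesis
    using eqpoll_sym eqpoll_trans by blast
qed

section \<open>Direct limits along injections\<close>

locale injective_system =
  fixes A :: "nat \<Rightarrow> 'a set" and f :: "nat \<Rightarrow> 'a \<Rightarrow> 'a"
  assumes maps: "\<And>k a. a \<in> A k \<Longrightarrow> f k a \<in> A (Suc k)"
    and inj: "\<And>k. inj_on (f k) (A k)"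
begin

lemma transition_in: "a \<in> A j \<Longrightarrow> transition f j d a \<in> A (j + d)"
  by (induction d) (auto intro: maps)

lemma transition_inj: "a \<in> A j \<Longrightarrow> b \<in> A j \<Longrightarrow> transition f j d a = transition f j d b \<Longrightarrow> a = b"
proof (induction d)
  case (Suc d)
  then have "transition f j d a = transition f j d b"
    using inj_onD[OF inj[of "j + d"]] transition_in by auto
  then show ?case
    using Suc by blast
qed simp

lemma transition_add: "transition f j (m + n) a = transition f (j + m) n (transition f j m a)"
  by (induction n) (auto simp: add.assoc)

definition limit_rel :: "((nat \<times> 'a) \<times> (nat \<times> 'a)) set" where
  "limit_rel = {((j, a), (k, b)). a \<in> A j \<and> b \<in> A k \<and>
     (\<exists>n. j \<le> n \<and> k \<le> n \<and> transition f j (n - j) a = transition f k (n - k) b)}"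

lemma direct_limit_eq: "direct_limit A f = Sigma UNIV A // limit_rel"
  by (simp add: direct_limit_def limit_rel_def)

lemma transition_mono:
  assumes "j \<le> n" "k \<le> n" "n \<le> m" "transition f j (n - j) a = transition f k (n - k) b"
  shows "transition f j (m - j) a = transition f k (m - k) b"
proof -
  have "m - j = (n - j) + (m - n)" "m - k = (n - k) + (m - n)"
    using assms by auto
  then show ?thesis
    using assms transition_add[of j "n - j" "m - n" a] transition_add[of k "n - k" "m - n" b] by simp
qed

lemma equiv_limit_rel: "equiv (Sigma UNIV A) limit_rel"
proof (rule equivI)
  show "limit_rel \<subseteq> Sigma UNIV A \<times> Sigma UNIV A"
    by (auto simp: limit_rel_def)
  show "refl_on (Sigma UNIV A) limit_rel"
    by (auto simp: refl_on_def limit_rel_def)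
  show "sym limit_rel"
    unfolding sym_def limit_rel_def by (auto simp: eq_commute)
  show "trans limit_rel"
  proof (rule transI)
    fix x y z assume "(x, y) \<in> limit_rel" "(y, z) \<in> limit_rel"
    then obtain i a j b k c n m where *: "x = (i, a)" "y = (j, b)" "z = (k, c)" "a \<in> A i" "c \<in> A k"
      "i \<le> n" "j \<le> n" "transition f i (n - i) a = transition f j (n - j) b"
      "j \<le> m" "k \<le> m" "transition f j (m - j) b = transition f k (m - k) c"
      by (auto simp: limit_rel_def)
    have "transition f i (max n m - i) a = transition f j (max n m - j) b"
      by (rule transition_mono[OF *(6,7) _ *(8)]) simp
    also have "\<dots> = transition f k (max n m - k) c"
      by (rule transition_mono[OF *(9,10) _ *(11)]) simp
    finally show "(x, z) \<in> limit_rel"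
      using * by (auto simp: limit_rel_def intro!: exI[of _ "max n m"])
  qed
qed

definition stage :: "nat \<Rightarrow> 'a \<Rightarrow> (nat \<times> 'a) set" where "stage k a = limit_rel `` {(k, a)}"

lemma stage_in: "a \<in> A k \<Longrightarrow> stage k a \<in> direct_limit A f"
  unfolding direct_limit_eq stage_def by (rule quotientI) simp

lemma inj_stage: "inj_on (stage k) (A k)"
proof (rule inj_onI)
  fix a b assume ab: "a \<in> A k" "b \<in> A k" "stage k a = stage k b"
  then have "((k, a), (k, b)) \<in> limit_rel"
    using eq_equiv_class_iff[OF equiv_limit_rel, of "(k, a)" "(k, b)"] by (simp add: stage_def)
  then show "a = b"
    using transition_inj ab by (auto simp: limit_rel_def)
qed

lemma stage_transition:
  assumes "a \<in> A j"
  shows "stage (j + d) (transition f j d a) = stage j a"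
proof -
  have "((j + d, transition f j d a), (j, a)) \<in> limit_rel"
    using assms transition_in[OF assms, of d] by (auto simp: limit_rel_def intro!: exI[of _ "j + d"])
  then show ?thesis
    unfolding stage_def by (rule equiv_class_eq[OF equiv_limit_rel])
qed

lemma direct_limit_UN: "direct_limit A f = (\<Union>k. stage k ` A k)"
  unfolding direct_limit_eq quotient_def stage_def by auto

lemma stage_image_mono: "j \<le> k \<Longrightarrow> stage j ` A j \<subseteq> stage k ` A k"
proof
  fix z assume "j \<le> k" "z \<in> stage j ` A j"
  then obtain a where "a \<in> A j" "z = stage j a" "k = j + (k - j)"
    by auto
  then show "z \<in> stage k ` A k"
    using stage_transition[of a j "k - j"] transition_in[of a j "k - j"] by (metis imageI)
qed

lemma countable_direct_limit: "(\<And>k. countable (A k)) \<Longrightarrow> countable (direct_limit A f)"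
  unfolding direct_limit_UN by auto

lemma finite_subset_stage:
  assumes "finite F" "F \<subseteq> direct_limit A f"
  obtains k where "k0 \<le> k" "F \<subseteq> stage k ` A k"
proof -
  have "\<exists>k\<ge>k0. F \<subseteq> stage k ` A k"
    using assms
  proof (induction F)
    case (insert z F)
    then obtain k where k: "k0 \<le> k" "F \<subseteq> stage k ` A k"
      by auto
    obtain j where j: "z \<in> stage j ` A j"
      using insert.prems by (auto simp: direct_limit_UN)
    show ?case
      using k j stage_image_mono[of k "max j k"] stage_image_mono[of j "max j k"]
      by (intro exI[of _ "max j k"]) auto
  qed auto
  then show thesis
    using that by blast
qed

text \<open>No map between the limit and \<open>B\<close> is at hand, so finite subsets are
  compared. Those of the limit live at a late stage and embed into \<open>B\<close>; those of
  \<open>B\<close> embed into a stage and hence, by \<open>inj_stage\<close>, into the limit. For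
  countable sets this fixes the cardinality.\<close>

lemma direct_limit_eqpoll:
  assumes "\<And>k. countable (A k)" "countable B"
    and lepoll: "\<And>k. k0 \<le> k \<Longrightarrow> A k \<lesssim> B"
    and late: "\<And>F. finite F \<Longrightarrow> F \<subseteq> B \<Longrightarrow> \<exists>k. F \<lesssim> A k"
  shows "direct_limit A f \<approx> B"
proof -
  have below: "\<exists>F'. F' \<subseteq> direct_limit A f \<and> finite F' \<and> card F' = card F" if F: "finite F" "F \<subseteq> B" for F
  proof -
    obtain k g where g: "inj_on g F" "g ` F \<subseteq> A k"
      using late[OF F] by (auto simp: lepoll_def)
    have "inj_on (stage k \<circ> g) F"
      using g by (intro comp_inj_on inj_on_subset[OF inj_stage])
    then have "card ((stage k \<circ> g) ` F) = card F"
      by (rule card_image)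
    then show ?thesis
      using F g stage_in by (intro exI[of _ "(stage k \<circ> g) ` F"]) auto
  qed
  have above: "F \<lesssim> B" if F: "finite F" "F \<subseteq> direct_limit A f" for F
  proof -
    obtain k where k: "k0 \<le> k" "F \<subseteq> stage k ` A k"
      by (rule finite_subset_stage[OF F])
    have "F \<lesssim> stage k ` A k"
      by (rule subset_imp_lepoll[OF k(2)])
    also have "\<dots> \<lesssim> A k"
      by (rule image_lepoll)
    also have "\<dots> \<lesssim> B"
      by (rule lepoll[OF k(1)])
    finally show ?thesis .
  qed
  show ?thesis
  proof (cases "finite B")
    case True
    have bound: "card F \<le> card B" if "finite F" "F \<subseteq> direct_limit A f" for F
      using above[OF that] True that(1) by (simp add: lepoll_iff_card_le)
    have fin: "finite (direct_limit A f)"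
    proof (rule ccontr)
      assume "infinite (direct_limit A f)"
      then obtain F where "F \<subseteq> direct_limit A f" "finite F" "card F = Suc (card B)"
        using infinite_arbitrarily_large by blast
      then show False
        using bound[of F] by simp
    qed
    obtain F where "F \<subseteq> direct_limit A f" "finite F" "card F = card B"
      using below[OF True order_refl] by blast
    then have "card B \<le> card (direct_limit A f)"
      using fin card_mono by metis
    then have "card (direct_limit A f) = card B"
      using bound[OF fin order_refl] by simp
    then show ?thesis
      using fin True by (simp add: eqpoll_iff_card)
  next
    case False
    have "infinite (direct_limit A f)"
    proof
      assume fin: "finite (direct_limit A f)"
      obtain F where "F \<subseteq> B" "finite F" "card F = Suc (card (direct_limit A f))"
        using infinite_arbitrarily_large[OF False] by blast
      then show False
        using below[of F] card_mono[OF fin] by (metis Suc_n_not_le_n)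
    qed
    then show ?thesis
      by (rule countably_infinite_eqpoll[OF countable_direct_limit[OF assms(1)] _ assms(2) False])
  qed
qed

end

section \<open>Counting infinite components\<close>

lemma infinite_component_vertices:
  assumes "locally_finite_mgraph G" "wf_mgraph G" "Y \<in> infinite_components G X"
  shows "infinite (vertices Y)"
proof
  assume fin: "finite (vertices Y)"
  let ?H = "remove_subgraph G X"
  obtain y where Y: "Y = component_of ?H y"
    using assms(3) by (auto simp: infinite_components_def components_mgraph_def)
  have VY: "vertices Y \<subseteq> vertices G"
    using vertices_remove_subgraph_subset[OF assms(2), of X] by (auto simp: Y vertices_component_of)
  have "edges Y \<subseteq> (\<Union>v\<in>vertices Y. {e \<in> edges G. v \<in> set_uprod (ends G e)})"
  proof
    fix e assume "e \<in> edges Y"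
    then have "e \<in> edges G" "set_uprod (ends G e) \<subseteq> vertices Y"
      unfolding Y edges_component_of by (auto simp: remove_subgraph_def)
    then show "e \<in> (\<Union>v\<in>vertices Y. {e \<in> edges G. v \<in> set_uprod (ends G e)})"
      by (auto simp: ends_orient)
  qed
  moreover have "finite (\<Union>v\<in>vertices Y. {e \<in> edges G. v \<in> set_uprod (ends G e)})"
    using fin VY assms(1) by (auto simp: locally_finite_mgraph_def)
  ultimately have "finite (edges Y)"
    by (rule finite_subset)
  then show False
    using assms(3) fin by (simp add: infinite_components_def finite_mgraph_def)
qed

lemma vertices_reachable:
  assumes "(u, v) \<in> (adjacency (remove_subgraph G X))\<^sup>*" "u \<in> vertices (remove_subgraph G X)"
  shows "v \<in> vertices (remove_subgraph G X)"
  using assms vertices_remove_subgraph_arc(2)[of _ G X]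
  by (induction rule: rtrancl_induct) (auto simp: adjacency_remove_subgraph)

context rooted_graph
begin

lemma par_in_desc:
  assumes "w \<in> desc v" "w \<noteq> v"
  shows "w \<in> V - {r}" "par w \<in> desc v" "dist v < dist w"
proof -
  have w: "w \<in> V" "dist v \<le> dist w" "anc (dist v) w = v"
    using assms by (auto simp: desc_def)
  show less: "dist v < dist w"
    using w assms(2) by (metis anc_self le_neq_implies_less)
  then show w': "w \<in> V - {r}"
    using w root by auto
  show "par w \<in> desc v"
    using w less anc_par[OF w' less] dist_par[OF w'] par_in_V[OF w'] by (simp add: desc_def)
qed



text \<open>Below level \<open>L\<close> no tree edge is removed, so every subtree rooted at level
  \<open>L\<close> stays connected in the complement of \<open>X\<close>.\<close>

definition deep :: "('v, 'e) mgraph \<Rightarrow> nat \<Rightarrow> bool" where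
  "deep X L \<longleftrightarrow> (\<forall>w\<in>V - {r}. L < dist w \<longrightarrow> fst (pa w) \<notin> edges X)"

lemma exists_deep:
  assumes "finite_mgraph X"
  obtains L where "M \<le> L" "deep X L"
proof -
  let ?W = "{w \<in> V - {r}. fst (pa w) \<in> edges X}"
  have "finite ((\<lambda>w. fst (pa w)) ` ?W)"
    by (rule finite_subset[of _ "edges X"]) (use assms in \<open>auto simp: finite_mgraph_def\<close>)
  moreover have "inj_on (\<lambda>w. fst (pa w)) ?W"
    by (intro inj_onI fst_pa_inj) auto
  ultimately have "finite ?W"
    by (rule finite_imageD)
  then have bound: "dist w \<le> Max (insert M (dist ` ?W))" if "w \<in> ?W" for w
    using that by (intro Max_ge) auto
  have "M \<le> Max (insert M (dist ` ?W))"
    using \<open>finite ?W\<close> by (intro Max_ge) auto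
  moreover have "deep X (Max (insert M (dist ` ?W)))"
    unfolding deep_def
  proof (intro ballI impI notI)
    fix w assume "w \<in> V - {r}" "Max (insert M (dist ` ?W)) < dist w" "fst (pa w) \<in> edges X"
    then show False
      using bound[of w] by simp
  qed
  ultimately show thesis
    by (rule that)
qed

lemma tree_step:
  assumes "w \<in> V - {r}" "fst (pa w) \<notin> edges X"
  shows "(par w, w) \<in> adjacency (remove_subgraph G X)" "w \<in> vertices (remove_subgraph G X)"
    "par w \<in> vertices (remove_subgraph G X)"
proof -
  show "(par w, w) \<in> adjacency (remove_subgraph G X)"
    using assms pa_arc[OF assms(1)] src_pa[OF assms(1)] tgt_pa[OF assms(1)]
    unfolding adjacency_remove_subgraph by (intro CollectI exI[of _ "pa w"]) auto
  show "w \<in> vertices (remove_subgraph G X)" "par w \<in> vertices (remove_subgraph G X)"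
    using vertices_remove_subgraph_arc[OF pa_arc[OF assms(1)] assms(2)] src_pa[OF assms(1)] tgt_pa[OF assms(1)]
    by simp_all
qed

lemma desc_reachable:
  assumes "deep X (dist v)" "v \<in> V" "w \<in> desc v"
  shows "(v, w) \<in> (adjacency (remove_subgraph G X))\<^sup>*"
  using assms(3)
proof (induction "dist w" arbitrary: w rule: less_induct)
  case less
  show ?case
  proof (cases "w = v")
    case False
    note w = par_in_desc[OF less.prems False]
    have "(v, par w) \<in> (adjacency (remove_subgraph G X))\<^sup>*"
      using less.hyps[of "par w"] w dist_par[OF w(1)] by simp
    moreover have "(par w, w) \<in> adjacency (remove_subgraph G X)"
      using tree_step(1)[OF w(1)] assms(1) w by (simp add: deep_def)
    ultimately show ?thesis
      by (rule rtrancl_into_rtrancl)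
  qed simp
qed

lemma deep_component:
  assumes v: "live v" and deep: "deep X (dist v)"
  shows "v \<in> vertices (component_of (remove_subgraph G X) v)"
    "component_of (remove_subgraph G X) v \<in> infinite_components G X"
proof -
  let ?H = "remove_subgraph G X"
  have vV: "v \<in> V"
    using v by (simp add: live_def)
  have step: "w \<in> vertices ?H" if "w \<in> desc v" "w \<noteq> v" for w
    using par_in_desc[OF that] deep tree_step(2)[of w X] by (simp add: deep_def)
  \<comment> \<open>The complement has only endpoints of remaining edges as vertices; the edge from
    \<open>v\<close> to its preferred child makes \<open>v\<close> one of them.\<close>
  have pcv: "pc v \<in> V - {r}" "par (pc v) = v" "dist v < dist (pc v)"
    using pc_in[OF v] par_pc[OF v] dist_pc[OF v] by auto
  then have vH: "v \<in> vertices ?H"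
    using tree_step(3)[of "pc v" X] deep by (simp add: deep_def)
  then show "v \<in> vertices (component_of ?H v)"
    by (rule in_component_of_self)
  have "desc v \<subseteq> vertices (component_of ?H v)"
    using step vH desc_reachable[OF deep vV] by (auto simp: vertices_component_of)
  then have "infinite (vertices (component_of ?H v))"
    using v infinite_super by (auto simp: live_def)
  then show "component_of ?H v \<in> infinite_components G X"
    using vH by (auto simp: infinite_components_def components_mgraph_def finite_mgraph_def)
qed



text \<open>Levels are finite, so infinitely many vertices of \<open>Y\<close> lie below level
  \<open>L\<close>, and by pigeonhole infinitely many share an ancestor there. That ancestor is
  live, and the tree path to it avoids \<open>X\<close>, so it belongs to \<open>Y\<close>.\<close>

lemma component_meets_level:
  assumes Y: "Y \<in> infinite_components G X" and deep: "deep X L"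
  shows "\<exists>a\<in>vertices Y. live a \<and> dist a = L"
proof -
  let ?H = "remove_subgraph G X"
  have YH: "Y \<in> components_mgraph ?H"
    using Y by (simp add: infinite_components_def)
  then obtain y0 where Y0: "Y = component_of ?H y0"
    by (auto simp: components_mgraph_def)
  have VY: "vertices Y \<subseteq> V" "vertices Y \<subseteq> vertices ?H"
    using vertices_remove_subgraph_subset[OF wf, of X] by (auto simp: Y0 vertices_component_of)
  define D where "D = {y \<in> vertices Y. L < dist y}"
  have "finite (\<Union>n\<le>L. {v \<in> V. dist v = n})"
    using finite_level by auto
  then have "finite {y \<in> vertices Y. dist y \<le> L}"
    by (rule rev_finite_subset) (use VY in auto)
  moreover have "vertices Y = D \<union> {y \<in> vertices Y. dist y \<le> L}"
    by (auto simp: D_def)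
  ultimately have "infinite D"
    using infinite_component_vertices[OF loc_fin wf Y] by (metis finite_UnI)
  moreover have "finite (anc L ` D)"
    by (rule finite_subset[OF _ finite_level[of L]]) (use anc_in_V dist_anc VY in \<open>auto simp: D_def\<close>)
  ultimately obtain y where y: "y \<in> D" "infinite {x \<in> D. anc L x = anc L y}"
    using pigeonhole_infinite by blast
  define a where "a = anc L y"
  have yV: "y \<in> V" "L < dist y" "y \<in> vertices Y"
    using y VY by (auto simp: D_def)
  have a: "a \<in> V" "dist a = L"
    using anc_in_V[OF yV(1)] dist_anc[OF yV(1), of L] yV by (auto simp: a_def)
  have "{x \<in> D. anc L x = anc L y} \<subseteq> desc a"
    using VY by (auto simp: desc_def a D_def a_def[symmetric])
  then have "live a"
    using y(2) a infinite_super by (auto simp: live_def)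
  have "y \<in> desc a"
    using yV a by (simp add: desc_def a_def)
  then have "(a, y) \<in> (adjacency ?H)\<^sup>*"
    using desc_reachable[of X a y] deep a by simp
  then have "(y, a) \<in> (adjacency ?H)\<^sup>*"
    by (rule sym_adjacency_rtrancl)
  moreover have "y \<in> vertices ?H"
    using yV VY by auto
  ultimately have "a \<in> vertices (component_of ?H y)"
    using vertices_reachable by (auto simp: vertices_component_of)
  then have "a \<in> vertices Y"
    using component_eq_component_of[OF YH yV(3)] by simp
  then show ?thesis
    using \<open>live a\<close> a by auto
qed

definition live_level :: "nat \<Rightarrow> 'v set" where "live_level L = {a. live a \<and> dist a = L}"

lemma components_lepoll_level:
  assumes "deep X L"
  shows "infinite_components G X \<lesssim> live_level L"
proof -
  obtain g where g: "\<And>Y. Y \<in> infinite_components G X \<Longrightarrow> g Y \<in> vertices Y \<and> live (g Y) \<and> dist (g Y) = L"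
    using component_meets_level[OF _ assms] by metis
  have "inj_on g (infinite_components G X)"
  proof (rule inj_on_inverseI)
    fix Y assume Y: "Y \<in> infinite_components G X"
    then have "Y \<in> components_mgraph (remove_subgraph G X)"
      by (simp add: infinite_components_def)
    then show "component_of (remove_subgraph G X) (g Y) = Y"
      using component_eq_component_of g[OF Y] by metis
  qed
  then show ?thesis
    using g by (auto simp: lepoll_def live_level_def)
qed

section \<open>Rays of preferred children\<close>

lemma ray:
  assumes "live v"
  shows "live ((pc ^^ i) v)" "dist ((pc ^^ i) v) = dist v + i" "(par ^^ i) ((pc ^^ i) v) = v"
proof -
  have "live ((pc ^^ i) v) \<and> dist ((pc ^^ i) v) = dist v + i \<and> (par ^^ i) ((pc ^^ i) v) = v"
    using assms live_pc dist_pc par_pc by (induction i) (auto simp: funpow_swap1[of par])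
  then show "live ((pc ^^ i) v)" "dist ((pc ^^ i) v) = dist v + i" "(par ^^ i) ((pc ^^ i) v) = v"
    by auto
qed

lemma ray_start_exists: "live a \<Longrightarrow> \<exists>b\<in>ray_starts. \<exists>i. a = (pc ^^ i) b"
proof (induction "dist a" arbitrary: a rule: less_induct)
  case less
  show ?case
  proof (cases "a \<in> ray_starts")
    case True
    then show ?thesis by (intro bexI[of _ a] exI[of _ 0]) auto
  next
    case False
    then obtain v where v: "live v" "a = pc v"
      using less.prems by (auto simp: ray_starts_def)
    then obtain b i where "b \<in> ray_starts" "v = (pc ^^ i) b"
      using less.hyps[of v] dist_pc by auto
    then show ?thesis
      using v by (intro bexI[of _ b] exI[of _ "Suc i"]) auto
  qed
qed

text \<open>Stripping the smaller number of steps with \<open>par\<close> leaves one start as an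
  iterated preferred child of the other; a start is no preferred child, so the iteration is
  empty.\<close>

lemma ray_starts_unique:
  assumes "b \<in> ray_starts" "b' \<in> ray_starts" "(pc ^^ i) b = (pc ^^ j) b'"
  shows "b = b'"
proof -
  have *: "b = b'" if b: "b \<in> ray_starts" "b' \<in> ray_starts" "(pc ^^ i) b = (pc ^^ j) b'" "i \<le> j" for b b' i j
  proof -
    have live: "live b" "live b'"
      using b by (auto simp: ray_starts_def)
    have "(pc ^^ j) b' = (pc ^^ i) ((pc ^^ (j - i)) b')"
      using b(4) by (metis comp_apply funpow_add le_add_diff_inverse)
    then have "b = (pc ^^ (j - i)) b'"
      using ray(3)[OF live(1), of i] ray(3)[OF ray(1)[OF live(2)], of i] b(3) by metis
    then show ?thesis
      using b(1) ray(1)[OF live(2)] by (cases "j - i") (auto simp: ray_starts_def)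
  qed
  show ?thesis
    using *[of b b' i j] *[of b' b j i] assms by (metis linear)
qed

text \<open>A live vertex is determined by the start of its ray and its level.\<close>

lemma level_lepoll_ray_starts: "live_level L \<lesssim> ray_starts"
proof -
  obtain g h where g: "\<And>a. live a \<Longrightarrow> g a \<in> ray_starts \<and> a = (pc ^^ h a) (g a)"
    using ray_start_exists by metis
  have "inj_on g (live_level L)"
  proof (rule inj_onI)
    fix a a' assume a: "a \<in> live_level L" "a' \<in> live_level L" "g a = g a'"
    then have "dist (g a) + h a = dist (g a') + h a'"
      using g[of a] g[of a'] ray(2)[of "g a" "h a"] ray(2)[of "g a'" "h a'"] by (auto simp: live_level_def ray_starts_def)
    then show "a = a'"
      using a g[of a] g[of a'] by (auto simp: live_level_def)
  qed
  then show ?thesis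
    using g by (auto simp: lepoll_def live_level_def)
qed

lemma finite_ray_starts_lepoll_level:
  assumes "finite F" "F \<subseteq> ray_starts"
  shows "\<exists>L. F \<lesssim> live_level L"
proof -
  define L where "L = Max (insert 0 (dist ` F))"
  have le: "dist b \<le> L" if "b \<in> F" for b
    unfolding L_def using assms(1) that by (intro Max_ge) auto
  have "inj_on (\<lambda>b. (pc ^^ (L - dist b)) b) F"
    using assms(2) by (intro inj_onI) (blast intro: ray_starts_unique)
  moreover have "(pc ^^ (L - dist b)) b \<in> live_level L" if "b \<in> F" for b
    using that assms(2) le[OF that] ray(1,2)[of b "L - dist b"] by (auto simp: live_level_def ray_starts_def)
  ultimately show ?thesis
    by (intro exI[of _ L]) (auto simp: lepoll_def)
qed

text \<open>Every remaining edge is a tree edge whose lower end is strictly below level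
  \<open>L\<close>, and both its ends have the same ancestor at that level. This is where a graph of
  the exhaustion has to contain all chords.\<close>

lemma anc_component:
  assumes "chords \<subseteq> edges X" "\<And>w. w \<in> V - {r} \<Longrightarrow> dist w \<le> L \<Longrightarrow> fst (pa w) \<in> edges X"
    and "(u, v) \<in> (adjacency (remove_subgraph G X))\<^sup>*"
  shows "anc L u = anc L v"
  using assms(3)
proof (induction rule: rtrancl_induct)
  case (step y z)
  then obtain x where x: "x \<in> arcs (bigraph G)" "fst x \<notin> edges X" "y = src G x" "z = tgt G x"
    by (auto simp: adjacency_remove_subgraph)
  have par: "anc L (par w) = anc L w" if "w \<in> V - {r}" "fst (pa w) \<notin> edges X" for w
    using that assms(2)[of w] by (intro anc_par) (auto simp: not_le[symmetric])
  have "anc L y = anc L z"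
    using x(1)
  proof (cases rule: arc_cases)
    case chord
    then show ?thesis using x assms(1) by auto
  next
    case (down w)
    then show ?thesis using x par[of w] src_pa[of w] tgt_pa[of w] by simp
  next
    case (up w)
    then show ?thesis using x par[of w] src_pa[of w] tgt_pa[of w] by simp
  qed
  then show ?case
    using step by simp
qed simp

text \<open>The vertices of level \<open>L\<close> are pushed down their rays to a level deep enough
  for \<open>X\<close>, where they lie in infinite components. By \<open>anc_component\<close> their
  ancestors at level \<open>L\<close>, that is the original vertices, separate these
  components.\<close>

lemma level_lepoll_components:
  assumes "finite_mgraph X" "chords \<subseteq> edges X"
    and "\<And>w. w \<in> V - {r} \<Longrightarrow> dist w \<le> L \<Longrightarrow> fst (pa w) \<in> edges X"
  shows "live_level L \<lesssim> infinite_components G X"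
proof -
  obtain L' where L': "L \<le> L'" "deep X L'"
    using exists_deep[OF assms(1)] .
  define g where "g a = (pc ^^ (L' - L)) a" for a
  have g: "live (g a)" "dist (g a) = L'" "anc L (g a) = a" if "a \<in> live_level L" for a
    using ray[of a "L' - L"] that L'(1) by (auto simp: g_def live_level_def anc_def)
  define Y where "Y a = component_of (remove_subgraph G X) (g a)" for a
  have Y: "g a \<in> vertices (Y a)" "Y a \<in> infinite_components G X" if "a \<in> live_level L" for a
    using deep_component[of "g a" X] g[OF that] L'(2) by (auto simp: Y_def)
  have "inj_on Y (live_level L)"
  proof (rule inj_onI)
    fix a b assume ab: "a \<in> live_level L" "b \<in> live_level L" "Y a = Y b"
    then have "g b \<in> vertices (component_of (remove_subgraph G X) (g a))"
      using Y(1)[of b] by (simp only: Y_def)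
    then have "(g a, g b) \<in> (adjacency (remove_subgraph G X))\<^sup>*"
      by (simp add: vertices_component_of)
    then have "anc L (g a) = anc L (g b)"
      using anc_component[of X L "g a" "g b"] assms(2,3) by blast
    then show "a = b"
      using g(3) ab by simp
  qed
  then show ?thesis
    using Y by (auto simp: lepoll_def)
qed

lemma countable_edges: "countable (edges G)"
proof -
  have "edges G = (\<Union>v\<in>V. {e \<in> edges G. v \<in> set_uprod (ends G e)})"
    using wf by (fastforce simp: wf_mgraph_def ends_orient)
  moreover have "countable (\<Union>v\<in>V. {e \<in> edges G. v \<in> set_uprod (ends G e)})"
    using loc_fin by (intro countable_UN[OF countable_vertices] countable_finite) (simp add: locally_finite_mgraph_def)
  ultimately show ?thesis
    by simp
qed

lemma countable_chords: "countable chords"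
  using countable_edges by (rule countable_subset[rotated]) (auto simp: chords_def)

lemma countable_ray_starts: "countable ray_starts"
  using countable_vertices by (rule countable_subset[rotated]) (auto simp: ray_starts_def live_def)

section \<open>The valency set compared with the rays\<close>

context
  fixes X :: "nat \<Rightarrow> ('v, 'e) mgraph" and \<epsilon> :: "nat \<Rightarrow> ('v, 'e) mgraph \<Rightarrow> ('v, 'e) mgraph"
  assumes valency: "valency_choice G X \<epsilon>"
begin

lemma finite_X: "finite_mgraph (X k)"
  using valency by (simp add: valency_choice_def finite_exhaustion_def)

lemma exhaustion_finite_edges:
  assumes "finite F" "F \<subseteq> edges G"
  shows "\<exists>k. F \<subseteq> edges (X k)"
proof -
  have "edges (X k) \<subseteq> edges (X (Suc k))" for k
    using valency by (simp add: valency_choice_def finite_exhaustion_def subgraph_def)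
  then have mono: "edges (X j) \<subseteq> edges (X k)" if "j \<le> k" for j k
    using that by (rule lift_Suc_mono_le)
  have un: "(\<Union>k. edges (X k)) = edges G"
    using valency by (simp add: valency_choice_def finite_exhaustion_def)
  show ?thesis
    using assms
  proof (induction F)
    case (insert e F)
    then obtain j k where "F \<subseteq> edges (X k)" "e \<in> edges (X j)"
      using un by blast
    then show ?case
      using mono[of k "max j k"] mono[of j "max j k"] by (intro exI[of _ "max j k"]) auto
  qed auto
qed

interpretation injective_system "\<lambda>k. infinite_components G (X k)" \<epsilon>
  using valency by unfold_locales (auto simp: valency_choice_def)

lemma countable_components: "countable (infinite_components G (X k))"
proof -
  have "countable (vertices (remove_subgraph G (X k)))"
    using countable_vertices vertices_remove_subgraph_subset[OF wf] by (rule countable_subset[rotated])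
  then have "countable (components_mgraph (remove_subgraph G (X k)))"
    unfolding components_mgraph_def by (rule countable_image)
  then show ?thesis
    by (rule countable_subset[rotated]) (auto simp: infinite_components_def)
qed

lemma countable_valency_set: "countable (valency_set G X \<epsilon>)"
  unfolding valency_set_def by (rule countable_direct_limit) (rule countable_components)

text \<open>The ray from the root enters an infinite component of the first complement. One element
  of the set is needed to absorb the summand Z of \<open>homology_1_realization\<close>.\<close>

lemma valency_set_nonempty: "valency_set G X \<epsilon> \<noteq> {}"
proof -
  obtain L where L: "0 \<le> L" "deep (X 0) L"
    using exists_deep[OF finite_X] .
  have "live ((pc ^^ L) r)" "dist ((pc ^^ L) r) = L"
    using ray(1,2)[OF live_root] root by auto
  then have "component_of (remove_subgraph G (X 0)) ((pc ^^ L) r) \<in> infinite_components G (X 0)"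
    using deep_component(2) L by simp
  then show ?thesis
    unfolding valency_set_def using stage_in by blast
qed

lemma valency_set_eqpoll:
  assumes "finite chords"
  shows "valency_set G X \<epsilon> \<approx> ray_starts"
  unfolding valency_set_def
proof (rule direct_limit_eqpoll[OF countable_components countable_ray_starts])
  show "infinite_components G (X k) \<lesssim> ray_starts" if "0 \<le> k" for k
  proof -
    obtain L where "deep (X k) L"
      using exists_deep[OF finite_X] .
    then show ?thesis
      using components_lepoll_level level_lepoll_ray_starts lepoll_trans by blast
  qed
  show "\<exists>k. F \<lesssim> infinite_components G (X k)" if F: "finite F" "F \<subseteq> ray_starts" for F
  proof -
    obtain L where L: "F \<lesssim> live_level L"
      using finite_ray_starts_lepoll_level[OF F] by auto
    let ?W = "{w \<in> V - {r}. dist w \<le> L}"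
    have "finite (\<Union>n\<le>L. {v \<in> V. dist v = n})"
      using finite_level by auto
    then have "finite ?W"
      by (rule rev_finite_subset) auto
    then have "finite (chords \<union> (\<lambda>w. fst (pa w)) ` ?W)"
      using assms by simp
    moreover have "chords \<union> (\<lambda>w. fst (pa w)) ` ?W \<subseteq> edges G"
      using pa_arc by (auto simp: chords_def arcs_bigraph mem_Times_iff)
    \<comment> \<open>Finitely many chords and finite levels make this a finite set of edges, so one
      graph of the exhaustion contains it all.\<close>
    ultimately obtain k where k: "chords \<union> (\<lambda>w. fst (pa w)) ` ?W \<subseteq> edges (X k)"
      using exhaustion_finite_edges by blast
    have "live_level L \<lesssim> infinite_components G (X k)"
      by (rule level_lepoll_components[OF finite_X]) (use k in auto)
    then show ?thesis
      using lepoll_trans[OF L] by blast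
  qed
qed

end
end

section \<open>The isomorphism\<close>

lemma free_Abelian_group_Plus:
  "free_Abelian_group (A <+> B) \<cong> free_Abelian_group A \<times>\<times> free_Abelian_group B"
proof -
  define p where "p = frag_extend (case_sum frag_of (\<lambda>_ :: 'b. 0 :: 'a \<Rightarrow>\<^sub>0 int))"
  define q where "q = frag_extend (case_sum (\<lambda>_ :: 'a. 0 :: 'b \<Rightarrow>\<^sub>0 int) frag_of)"
  define i where "i = frag_extend (\<lambda>a :: 'a. frag_of (Inl a :: 'a + 'b))"
  define j where "j = frag_extend (\<lambda>b :: 'b. frag_of (Inr b :: 'a + 'b))"
  note defs = p_def q_def i_def j_def
  have pi: "p (i a) = a" and qi: "q (i a) = 0" for a
    unfolding defs using subset_UNIV by (induction a rule: frag_induction; simp add: frag_extend_diff)+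
  have pj: "p (j b) = 0" and qj: "q (j b) = b" for b
    unfolding defs using subset_UNIV by (induction b rule: frag_induction; simp add: frag_extend_diff)+
  have ij: "i (p c) + j (q c) = c" for c
    using subset_UNIV
  proof (induction c rule: frag_induction)
    case (one x)
    then show ?case
      by (cases x rule: sum.exhaust) (simp_all add: defs)
  next
    case (diff a b)
    have "i (p (a - b)) + j (q (a - b)) = (i (p a) + j (q a)) - (i (p b) + j (q b))"
      by (simp add: defs frag_extend_diff)
    then show ?case
      by (simp only: diff)
  qed (simp add: defs)
  have keys: "Poly_Mapping.keys (p c) \<subseteq> A" "Poly_Mapping.keys (q c) \<subseteq> B"
    if "Poly_Mapping.keys c \<subseteq> A <+> B" for c
  proof -
    have "Poly_Mapping.keys (p c) \<subseteq> (\<Union>x\<in>Poly_Mapping.keys c. Poly_Mapping.keys (case x of Inl a \<Rightarrow> frag_of a | Inr _ \<Rightarrow> 0))"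
      unfolding p_def by (rule keys_frag_extend)
    also have "\<dots> \<subseteq> A"
      using that by (auto split: sum.splits)
    finally show "Poly_Mapping.keys (p c) \<subseteq> A" .
    have "Poly_Mapping.keys (q c) \<subseteq> (\<Union>x\<in>Poly_Mapping.keys c. Poly_Mapping.keys (case x of Inl _ \<Rightarrow> 0 | Inr b \<Rightarrow> frag_of b))"
      unfolding q_def by (rule keys_frag_extend)
    also have "\<dots> \<subseteq> B"
      using that by (auto split: sum.splits)
    finally show "Poly_Mapping.keys (q c) \<subseteq> B" .
  qed
  have keys': "Poly_Mapping.keys (i a + j b) \<subseteq> A <+> B"
    if "Poly_Mapping.keys a \<subseteq> A" "Poly_Mapping.keys b \<subseteq> B" for a b
    using that keys_add[of "i a" "j b"] keys_frag_extend[of "\<lambda>a. frag_of (Inl a)" a]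
      keys_frag_extend[of "\<lambda>b. frag_of (Inr b)" b] unfolding i_def j_def by fastforce
  have "(\<lambda>c. (p c, q c)) \<in> iso (free_Abelian_group (A <+> B)) (free_Abelian_group A \<times>\<times> free_Abelian_group B)"
  proof (rule isoI)
    show "(\<lambda>c. (p c, q c)) \<in> hom (free_Abelian_group (A <+> B)) (free_Abelian_group A \<times>\<times> free_Abelian_group B)"
      using keys by (auto simp: hom_def p_def q_def frag_extend_add)
    show "bij_betw (\<lambda>c. (p c, q c)) (carrier (free_Abelian_group (A <+> B)))
        (carrier (free_Abelian_group A \<times>\<times> free_Abelian_group B))"
    proof (rule bij_betw_byWitness[where f' = "\<lambda>(a, b). i a + j b"])
      have add: "p (x + y) = p x + p y" "q (x + y) = q x + q y" for x y
        by (simp_all add: p_def q_def frag_extend_add)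
      show "\<forall>c\<in>carrier (free_Abelian_group A \<times>\<times> free_Abelian_group B).
          (\<lambda>c. (p c, q c)) ((\<lambda>(a, b). i a + j b) c) = c"
        by (auto simp: add pi qi pj qj)
    qed (use keys keys' ij in auto)
  qed
  then show ?thesis
    by (rule is_isoI)
qed

lemma DirProd_assoc: "(G \<times>\<times> H) \<times>\<times> K \<cong> G \<times>\<times> (H \<times>\<times> K)"
proof -
  have "(\<lambda>((x, y), z). (x, (y, z))) \<in> iso ((G \<times>\<times> H) \<times>\<times> K) (G \<times>\<times> (H \<times>\<times> K))"
    by (auto simp: iso_def hom_def inj_on_def bij_betw_def image_iff)
  then show ?thesis
    by (rule is_isoI)
qed

theorem corollary6p2:
  fixes G :: "('v, 'e) mgraph"
    and X :: "nat \<Rightarrow> ('v, 'e) mgraph"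
    and \<epsilon> :: "nat \<Rightarrow> ('v, 'e) mgraph \<Rightarrow> ('v, 'e) mgraph"
  assumes "wf_mgraph G"
    and "\<not> finite_mgraph G"
    and "connected_mgraph G"
    and "locally_finite_mgraph G"
    and "valency_choice G X \<epsilon>"
  shows "K0 G \<cong> homology_group 1 (geometric_realization G)
               \<times>\<times> free_Abelian_group (valency_set G X \<epsilon>)"
proof -
  obtain r dist pa where "rooted_graph G r dist pa"
    using exists_rooted_graph[OF assms(1-4)] .
  then interpret rooted_graph G r dist pa .
  let ?V = "valency_set G X \<epsilon>"
  obtain v0 where v0: "v0 \<in> ?V"
    using valency_set_nonempty[OF assms(5)] by blast
  \<comment> \<open>The removed element accounts for the extra Z: the valency set has the size of
    one point plus \<open>V'\<close>, and that point is traded for the integers next to H_1.\<close>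
  define V' where "V' = ?V - {v0}"
  let ?U = "UNIV :: unit set"
  have V: "?U <+> V' \<approx> ?V"
  proof -
    have "bij_betw (case_sum (\<lambda>_. v0) id) (?U <+> V') ?V"
      using v0 by (intro bij_betw_imageI) (auto simp: inj_on_def V'_def Plus_def image_Un image_image)
    then show ?thesis
      by (auto simp: eqpoll_def)
  qed
  have card: "(?U <+> chords) <+> V' \<approx> Inl ` chords \<union> Inr ` ray_starts"
  proof (cases "finite chords")
    case True
    have "Inl ` chords \<union> Inr ` ray_starts = chords <+> ray_starts"
      by (simp add: Plus_def)
    moreover have "(?U <+> chords) <+> V' \<approx> chords <+> (?U <+> V')"
    proof -
      have "bij_betw (case_sum (case_sum (Inr \<circ> Inl) Inl) (Inr \<circ> Inr)) ((?U <+> chords) <+> V') (chords <+> (?U <+> V'))"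
        by (rule bij_betw_byWitness[where f' = "case_sum (Inl \<circ> Inr) (case_sum (Inl \<circ> Inl) Inr)"]) auto
      then show ?thesis
        by (auto simp: eqpoll_def)
    qed
    moreover have "chords <+> (?U <+> V') \<approx> chords <+> ray_starts"
      using eqpoll_trans[OF V valency_set_eqpoll[OF assms(5) True]] by (intro sum_eqpoll_cong) auto
    ultimately show ?thesis
      by (simp only:) (rule eqpoll_trans)
  next
    \<comment> \<open>Here rays and valency set need not match, but the infinitely many chords
      already make both ranks countably infinite.\<close>
    case False
    have "countable ((?U <+> chords) <+> V')" "countable (Inl ` chords \<union> Inr ` ray_starts)"
      using countable_chords countable_ray_starts countable_valency_set[OF assms(5)]
      by (auto simp: V'_def Plus_def)
    moreover have "infinite ((?U <+> chords) <+> V')" "infinite (Inl ` chords \<union> Inr ` ray_starts)"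
      using False by (auto simp: finite_image_iff)
    ultimately show ?thesis
      by (intro countably_infinite_eqpoll)
  qed
  let ?H = "homology_group 1 (geometric_realization G)" and ?M = "free_Abelian_group V'"
  have Z: "free_Abelian_group ?U \<cong> integer_group"
    unfolding UNIV_unit
    by (rule group.iso_sym[OF group_integer_group isomorphic_group_integer_free_Abelian_group_singleton])
  have "free_Abelian_group ?V \<cong> free_Abelian_group (?U <+> V')"
    using eqpoll_sym[OF V] by (simp add: isomorphic_free_Abelian_groups)
  also have "\<dots> \<cong> free_Abelian_group ?U \<times>\<times> ?M"
    by (rule free_Abelian_group_Plus)
  also have "\<dots> \<cong> integer_group \<times>\<times> ?M"
    by (rule group.DirProd_iso_trans[OF _ Z iso_refl]) simp
  finally have VZ: "free_Abelian_group ?V \<cong> integer_group \<times>\<times> ?M" .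
  have "?H \<times>\<times> free_Abelian_group ?V \<cong> ?H \<times>\<times> (integer_group \<times>\<times> ?M)"
    by (rule group.DirProd_iso_trans[OF _ iso_refl VZ]) simp
  also have "\<dots> \<cong> (?H \<times>\<times> integer_group) \<times>\<times> ?M"
    by (rule group.iso_sym[OF _ DirProd_assoc]) (intro DirProd_group; simp)
  also have "\<dots> \<cong> (integer_group \<times>\<times> ?H) \<times>\<times> ?M"
    by (rule group.DirProd_iso_trans[OF _ DirProd_commute_iso iso_refl]) (intro DirProd_group; simp)
  also have "\<dots> \<cong> free_Abelian_group (?U <+> chords) \<times>\<times> ?M"
    by (rule group.DirProd_iso_trans[OF _ homology_1_realization iso_refl]) (intro DirProd_group; simp)
  also have "\<dots> \<cong> free_Abelian_group ((?U <+> chords) <+> V')"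
    by (rule group.iso_sym[OF _ free_Abelian_group_Plus]) simp
  also have "\<dots> \<cong> free_Abelian_group (Inl ` chords \<union> Inr ` ray_starts)"
    using card by (simp add: isomorphic_free_Abelian_groups)
  finally have "free_Abelian_group (Inl ` chords \<union> Inr ` ray_starts) \<cong> ?H \<times>\<times> free_Abelian_group ?V"
    by (rule group.iso_sym[rotated]) (intro DirProd_group; simp)
  with K0_free show ?thesis
    by (rule iso_trans)
qed

end
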